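(* Let $X=\prod_{n=1}^\infty X_n$ be a product of finite-dimensional normed spaces $X_n$ with $X_n\neq\{0\}$ for all $n$, let $a\in X$ and let $W\subseteq\sigma(a)$. Then $W$ is the discontinuity point set of some strongly separately continuous function $f:(\sigma(a),\tau)\to\mathbb R$ if and only if $W$ is nearly open in $(\sigma(a),\tau)$.
   Context: $\sigma(a)$ is the set of all $y=(y_n)_{n=1}^\infty\in X$ such that $\{n:y_n\neq a_n\}$ is finite. $\tau$ denotes the Tychonoff product topology (each $X_n$ carrying its norm topology); $(\sigma(a),\tau)$ is $\sigma(a)$ with the subspace topology. For points $x,u\in X$ and $n\in\mathbb N$, $x_n^u$ denotes the point obtained from $x$ by replacing its $n$-th coordinate by $u_n$. For a finite set $T_0\subseteq\mathbb N$ and $z\in\prod_{n\in T_0}X_n$, $a_{T_0}^z$ denotes the point of $X$ whose $n$-th coordinate is $z_n$ if $n\in T_0$ and $a_n$ otherwise. A function $f:(\sigma(a),\tau)\to\mathbb R$ is strongly separately continuous if for every $u\in\sigma(a)$ and every $n\in\mathbb N$ one has $\lim_{x\to u}|f(x)-f(x_n^u)|=0$, the limit being taken over $x\in\sigma(a)$ in the topology $\tau$. The discontinuity point set of $f$ is the set of all points of $\sigma(a)$ at which $f$ is not continuous. A set $W\subseteq\sigma(a)$ is nearly open in $(\sigma(a),\tau)$ if for every finite set $T_0\subseteq \mathbb N$ the set $W_{T_0}=\{z\in\prod_{n\in T_0}X_n:\ a_{T_0}^z\in W\}$ is open in $\prod_{n\in T_0}X_n$ with the product topology. *)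

theory Defs
  imports "HOL-Analysis.Analysis"
begin

text \<open>
  A finite-dimensional real normed space is presented as a finite-dimensional subspace of some real
  vector space, with a norm \<open>nrm\<close> of its own; no norm on the ambient type is involved. A sequence of
  such spaces can live in a single ambient type (for instance, embed it into its direct sum), so that
  both the spaces and their norms vary freely with the index. Complex normed spaces are covered by
  restriction of scalars.
\<close>

locale fin_dim_normed_space =
  fixes V :: "'a::real_vector set" and nrm :: "'a \<Rightarrow> real"
  assumes subspace: "subspace V"
    and fin_dim: "\<exists>B. finite B \<and> span B = V"
    and nrm_nonneg: "x \<in> V \<Longrightarrow> 0 \<le> nrm x"
    and nrm_eq_zero_iff: "x \<in> V \<Longrightarrow> nrm x = 0 \<longleftrightarrow> x = 0"
    and nrm_scaleR: "x \<in> V \<Longrightarrow> nrm (c *\<^sub>R x) = \<bar>c\<bar> * nrm x"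
    and nrm_triangle: "x \<in> V \<Longrightarrow> y \<in> V \<Longrightarrow> nrm (x + y) \<le> nrm x + nrm y"

text \<open>
  The value \<open>0\<close> outside \<open>V\<close> is needed because \<^locale>\<open>Metric_space\<close> demands a nonnegative symmetric
  distance on the whole type; the topology only depends on the values on \<open>V\<close>.
\<close>

definition norm_dist :: "'a::real_vector set \<Rightarrow> ('a \<Rightarrow> real) \<Rightarrow> 'a \<Rightarrow> 'a \<Rightarrow> real"
  where "norm_dist V nrm x y = (if x \<in> V \<and> y \<in> V then nrm (x - y) else 0)"

definition norm_topology :: "'a::real_vector set \<Rightarrow> ('a \<Rightarrow> real) \<Rightarrow> 'a topology"
  where "norm_topology V nrm = Metric_space.mtopology V (norm_dist V nrm)"

lemma (in fin_dim_normed_space) Metric_space_norm_dist: "Metric_space V (norm_dist V nrm)"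
proof
  fix x y z
  show "0 \<le> norm_dist V nrm x y"
    by (simp add: norm_dist_def nrm_nonneg subspace subspace_diff)
  show "norm_dist V nrm x y = norm_dist V nrm y x"
    using nrm_scaleR[of "x - y" "-1"] by (simp add: norm_dist_def subspace subspace_diff)
  assume xy: "x \<in> V" "y \<in> V"
  then show "norm_dist V nrm x y = 0 \<longleftrightarrow> x = y"
    by (simp add: norm_dist_def nrm_eq_zero_iff subspace subspace_diff)
  assume "z \<in> V"
  then show "norm_dist V nrm x z \<le> norm_dist V nrm x y + norm_dist V nrm y z"
    using xy nrm_triangle[of "x - y" "y - z"] by (simp add: norm_dist_def subspace subspace_diff)
qed

lemma (in fin_dim_normed_space) topspace_norm_topology: "topspace (norm_topology V nrm) = V"
  by (simp add: norm_topology_def Metric_space.topspace_mtopology Metric_space_norm_dist)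

definition \<sigma> :: "(nat \<Rightarrow> 'a set) \<Rightarrow> (nat \<Rightarrow> 'a) \<Rightarrow> (nat \<Rightarrow> 'a) set"
  where "\<sigma> V a = {y \<in> PiE UNIV V. finite {n. y n \<noteq> a n}}"

definition \<sigma>_topology ::
    "(nat \<Rightarrow> 'a::real_vector set) \<Rightarrow> (nat \<Rightarrow> 'a \<Rightarrow> real) \<Rightarrow> (nat \<Rightarrow> 'a) \<Rightarrow> (nat \<Rightarrow> 'a) topology"
  where "\<sigma>_topology V nrm a =
    subtopology (product_topology (\<lambda>n. norm_topology (V n) (nrm n)) UNIV) (\<sigma> V a)"

text \<open>
  Functions on \<open>\<sigma> V a\<close> are total functions on the ambient type whose values elsewhere are ignored.
  The filter \<^term>\<open>atin Y u\<close> excludes \<open>u\<close> itself, which is immaterial here because the expression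
  vanishes at \<open>x = u\<close>.
\<close>

definition strongly_separately_continuous ::
    "(nat \<Rightarrow> 'a::real_vector set) \<Rightarrow> (nat \<Rightarrow> 'a \<Rightarrow> real) \<Rightarrow> (nat \<Rightarrow> 'a) \<Rightarrow> ((nat \<Rightarrow> 'a) \<Rightarrow> real) \<Rightarrow> bool"
  where "strongly_separately_continuous V nrm a f \<longleftrightarrow>
    (\<forall>u\<in>\<sigma> V a. \<forall>n. ((\<lambda>x. \<bar>f x - f (x(n := u n))\<bar>) \<longlongrightarrow> 0) (atin (\<sigma>_topology V nrm a) u))"

definition discontinuity_set ::
    "(nat \<Rightarrow> 'a::real_vector set) \<Rightarrow> (nat \<Rightarrow> 'a \<Rightarrow> real) \<Rightarrow> (nat \<Rightarrow> 'a) \<Rightarrow> ((nat \<Rightarrow> 'a) \<Rightarrow> real)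
      \<Rightarrow> (nat \<Rightarrow> 'a) set"
  where "discontinuity_set V nrm a f =
    {x \<in> \<sigma> V a. \<not> topcontinuous_at (\<sigma>_topology V nrm a) euclideanreal f x}"

definition nearly_open ::
    "(nat \<Rightarrow> 'a::real_vector set) \<Rightarrow> (nat \<Rightarrow> 'a \<Rightarrow> real) \<Rightarrow> (nat \<Rightarrow> 'a) \<Rightarrow> (nat \<Rightarrow> 'a) set \<Rightarrow> bool"
  where "nearly_open V nrm a W \<longleftrightarrow> W \<subseteq> \<sigma> V a \<and>
    (\<forall>T. finite T \<longrightarrow>
      openin (product_topology (\<lambda>n. norm_topology (V n) (nrm n)) T)
        {z \<in> PiE T V. override_on a z T \<in> W})"

end

theory Submission
  imports Defs
begin

text \<open>
  If \<open>f\<close> is strongly separately continuous, then near \<open>u\<close> it changes little when finitely many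
  coordinates are reset to those of \<open>u\<close>; hence a jump of \<open>f\<close> at \<open>u\<close> is transported to every nearby
  point that differs from \<open>u\<close> only in these coordinates, and the discontinuity set is nearly open.

  Conversely, let \<open>W\<close> be nearly open. By compactness in the finite-dimensional factors, there are
  \<open>d n > 0\<close> such that every \<open>x \<in> W\<close> has a box \<open>{y. \<forall>n. \<parallel>y n - x n\<parallel> < c * d n}\<close> inside \<open>W\<close>. Let \<open>f x\<close> be
  the infimum of the numbers \<open>1 / (1 + \<parallel>x n - a n\<parallel>)\<close> and of the distances of \<open>x\<close> from the points
  \<open>y \<notin> W\<close>, where the first coordinates are weighted by \<open>1 / d n\<close>, while those beyond the support
  of \<open>y - a\<close> are truncated at \<open>1 / (n + 1)\<close>. Then \<open>f\<close> is Lipschitz in each coordinate; it vanishes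
  off \<open>W\<close> and is continuous there because of the truncation; it is positive on \<open>W\<close> because of the
  boxes, and discontinuous there because the first family makes it arbitrarily small near every point.
\<close>

section \<open>Finite-dimensional normed spaces\<close>

context fin_dim_normed_space
begin

lemma nrm_zero [simp]: "nrm 0 = 0"
  using nrm_eq_zero_iff subspace subspace_0 by blast

lemma nrm_minus_commute: "x \<in> V \<Longrightarrow> y \<in> V \<Longrightarrow> nrm (x - y) = nrm (y - x)"
  using nrm_scaleR[of "x - y" "-1"] by (simp add: subspace subspace_diff)

lemma nrm_diff_triangle:
  "x \<in> V \<Longrightarrow> y \<in> V \<Longrightarrow> z \<in> V \<Longrightarrow> nrm (x - z) \<le> nrm (x - y) + nrm (y - z)"
  using nrm_triangle[of "x - y" "y - z"] by (simp add: subspace subspace_diff)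

text \<open>The premise \<open>compact\<close> is what the induction in
  \<open>bounded_subsequence_span\<close> supplies for the span built so far. It makes S closed: a
  sequence in S approaching b would be bounded and would subconverge to b inside S. So b has a
  positive distance d from S, and homogeneity turns d into a bound on the coefficient of b.\<close>

lemma bounded_coefficient:
  assumes S: "subspace S" "S \<subseteq> V" and b: "b \<in> V" "b \<notin> S"
    and compact: "\<And>x B. (\<And>j::nat. x j \<in> S \<and> nrm (x j) \<le> B) \<Longrightarrow>
      \<exists>l\<in>S. \<exists>r. strict_mono r \<and> (\<lambda>j. nrm (x (r j) - l)) \<longlonglongrightarrow> 0"
  shows "\<exists>d>0. \<forall>y\<in>S. \<forall>t. d * \<bar>t\<bar> \<le> nrm (t *\<^sub>R b + y)"
proof -
  have "\<exists>d>0. \<forall>y\<in>S. d \<le> nrm (b - y)"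
  proof (rule ccontr)
    assume "\<not> ?thesis"
    then have "\<exists>y\<in>S. nrm (b - y) < inverse (real (Suc j))" for j
      by (metis inverse_positive_iff_positive not_le of_nat_0_less_iff zero_less_Suc)
    then obtain y where y: "\<And>j. y j \<in> S" "\<And>j. nrm (b - y j) < inverse (real (Suc j))"
      by metis
    have yV: "y j \<in> V" for j
      using y(1) S(2) by blast
    have "nrm (y j) \<le> nrm b + 1" for j
    proof -
      have "nrm (y j - 0) \<le> nrm (y j - b) + nrm (b - 0)"
        using yV b(1) subspace subspace_0 by (intro nrm_diff_triangle) auto
      moreover have "nrm (y j - b) < inverse (real (Suc j))"
        using y(2) yV b(1) nrm_minus_commute by simp
      moreover have "inverse (real (Suc j)) \<le> 1"
        by (simp add: inverse_le_1_iff)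
      ultimately show ?thesis by simp
    qed
    then obtain l r where l: "l \<in> S" "strict_mono r" "(\<lambda>j. nrm (y (r j) - l)) \<longlonglongrightarrow> 0"
      using compact[of y "nrm b + 1"] y(1) by blast
    have lV: "l \<in> V" using l(1) S(2) by blast
    have le: "nrm (b - l) \<le> inverse (real (Suc (r j))) + nrm (y (r j) - l)" for j
      using nrm_diff_triangle[OF b(1) yV[of "r j"] lV] y(2)[of "r j"] by linarith
    have "(\<lambda>j. inverse (real (Suc (r j))) + nrm (y (r j) - l)) \<longlonglongrightarrow> 0 + 0"
      by (intro tendsto_add l(3)
          LIMSEQ_subseq_LIMSEQ[OF LIMSEQ_inverse_real_of_nat l(2), unfolded o_def])
    then have "nrm (b - l) \<le> 0"
      using le by (intro LIMSEQ_le_const[where X="\<lambda>j. inverse (real (Suc (r j))) + nrm (y (r j) - l)"]) auto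
    then have "b = l"
      using nrm_nonneg[of "b - l"] nrm_eq_zero_iff[of "b - l"] b(1) lV
      by (simp add: subspace subspace_diff)
    with b(2) l(1) show False by simp
  qed
  then obtain d where d: "d > 0" "\<And>y. y \<in> S \<Longrightarrow> d \<le> nrm (b - y)" by blast
  have "d * \<bar>t\<bar> \<le> nrm (t *\<^sub>R b + y)" if y: "y \<in> S" for y t
  proof (cases "t = 0")
    case True
    then show ?thesis using y S(2) nrm_nonneg by auto
  next
    case False
    define y' where "y' = (- inverse t) *\<^sub>R y"
    have y': "y' \<in> S" unfolding y'_def by (rule subspace_scale[OF S(1) y])
    have "t *\<^sub>R b + y = t *\<^sub>R (b - y')"
      using False by (simp add: y'_def algebra_simps)
    then have "nrm (t *\<^sub>R b + y) = \<bar>t\<bar> * nrm (b - y')"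
      using nrm_scaleR[of "b - y'" t] b(1) y' S(2) subspace subspace_diff by fastforce
    then show ?thesis
      using mult_left_mono[OF d(2)[OF y'], of "\<bar>t\<bar>"] by (simp add: mult.commute)
  qed
  with d(1) show ?thesis by blast
qed

text \<open>Bolzano-Weierstrass for an arbitrary norm, by induction on the spanning set. If b is not
  redundant, the coefficients of b along a bounded sequence are bounded by
  \<open>bounded_coefficient\<close>, so they converge along some r. The remainders in
  \<open>span B\<close> are then bounded as well, and the induction hypothesis refines r by
  s.\<close>

lemma bounded_subsequence_span:
  assumes "finite B" "B \<subseteq> V" "\<And>j::nat. x j \<in> span B \<and> nrm (x j) \<le> M"
  shows "\<exists>l\<in>span B. \<exists>r. strict_mono r \<and> (\<lambda>j. nrm (x (r j) - l)) \<longlonglongrightarrow> 0"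
  using assms
proof (induction B arbitrary: x M rule: finite_induct)
  case empty
  then have "x j = 0" for j by simp
  then show ?case by (intro bexI[of _ 0] exI[of _ "\<lambda>j. j"]) (auto simp: strict_mono_def)
next
  case (insert b B)
  show ?case
  proof (cases "b \<in> span B")
    case True
    then have "span (insert b B) = span B" by (rule span_redundant)
    then have "\<And>j. x j \<in> span B \<and> nrm (x j) \<le> M" using insert.prems(2) by simp
    then have "\<exists>l\<in>span B. \<exists>r. strict_mono r \<and> (\<lambda>j. nrm (x (r j) - l)) \<longlonglongrightarrow> 0"
      using insert.prems(1) by (intro insert.IH) auto
    with True show ?thesis by (simp add: span_redundant)
  next
    case False
    have S: "subspace (span B)" "span B \<subseteq> V"
      using insert.prems(1) subspace span_minimal by auto
    have b: "b \<in> V" using insert.prems(1) by simp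
    obtain d where d: "d > 0" "\<And>y t. y \<in> span B \<Longrightarrow> d * \<bar>t\<bar> \<le> nrm (t *\<^sub>R b + y)"
      using bounded_coefficient[OF S b False] insert.IH insert.prems(1) by (metis insert_subset)
    have "\<exists>t. x j - t *\<^sub>R b \<in> span B" for j
      using insert.prems(2) by (auto simp: span_breakdown_eq)
    then obtain t where t: "\<And>j. x j - t j *\<^sub>R b \<in> span B" by metis
    define y where "y j = x j - t j *\<^sub>R b" for j
    have y: "y j \<in> span B" "y j \<in> V" for j using t y_def S(2) by auto
    have x: "x j = t j *\<^sub>R b + y j" for j by (simp add: y_def)
    have tb: "t j *\<^sub>R b \<in> V" for j by (simp add: b subspace subspace_scale)
    have M: "nrm (x j) \<le> M" for j using insert.prems(2) by blast
    have tM: "\<bar>t j\<bar> \<le> M / d" for j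
      using d(2)[OF y(1), of "t j" j] M[of j] d(1) by (simp add: x field_simps)
    have "bounded (range t)" using tM by (auto simp: bounded_iff)
    then obtain t0 r where t0: "strict_mono r" "(t \<circ> r) \<longlonglongrightarrow> t0"
      using bounded_imp_convergent_subsequence by blast
    have "nrm (y j) \<le> M + M / d * nrm b" for j
    proof -
      have "nrm (y j) = nrm (x j + (- t j) *\<^sub>R b)" by (simp add: x)
      also have "\<dots> \<le> nrm (x j) + nrm ((- t j) *\<^sub>R b)"
        using tb y b by (intro nrm_triangle) (auto simp: x subspace subspace_add subspace_scale subspace_neg)
      also have "nrm ((- t j) *\<^sub>R b) = \<bar>t j\<bar> * nrm b" using nrm_scaleR[OF b, of "- t j"] by simp
      also have "\<dots> \<le> M / d * nrm b" by (intro mult_right_mono tM nrm_nonneg b)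
      finally show ?thesis using M[of j] by simp
    qed
    then have "\<exists>l\<in>span B. \<exists>s. strict_mono s \<and> (\<lambda>j. nrm ((y \<circ> r) (s j) - l)) \<longlonglongrightarrow> 0"
      using y insert.prems(1) by (intro insert.IH[where M="M + M / d * nrm b"]) auto
    then obtain l s where l: "l \<in> span B" "strict_mono s"
      "(\<lambda>j. nrm ((y \<circ> r) (s j) - l)) \<longlonglongrightarrow> 0" by blast
    have lV: "l \<in> V" using l(1) S(2) by blast
    let ?l = "t0 *\<^sub>R b + l" and ?r = "r \<circ> s"
    have lim: "(\<lambda>j. t (?r j) - t0) \<longlonglongrightarrow> 0"
      using LIMSEQ_subseq_LIMSEQ[OF t0(2) l(2)] by (simp add: o_def LIM_zero)
    have le: "nrm (x (?r j) - ?l) \<le> \<bar>t (?r j) - t0\<bar> * nrm b + nrm (y (?r j) - l)" for j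
    proof -
      have "x (?r j) - ?l = (t (?r j) - t0) *\<^sub>R b + (y (?r j) - l)"
        by (simp add: x algebra_simps)
      then show ?thesis
        using nrm_triangle[of "(t (?r j) - t0) *\<^sub>R b" "y (?r j) - l"] nrm_scaleR[OF b]
        by (simp only: b y lV subspace subspace_scale subspace_diff simp_thms)
    qed
    have bd: "(\<lambda>j. \<bar>t (?r j) - t0\<bar> * nrm b + nrm (y (?r j) - l)) \<longlonglongrightarrow> 0"
      using tendsto_add[OF tendsto_mult_right[OF tendsto_rabs_zero[OF lim], of "nrm b"] l(3)]
      by (simp add: o_def)
    have "x j - ?l \<in> V" for j
      by (simp add: x b y lV subspace subspace_scale subspace_diff subspace_add)
    then have "(\<lambda>j. nrm (x (?r j) - ?l)) \<longlonglongrightarrow> 0"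
      by (intro tendsto_sandwich[OF _ _ tendsto_const bd] always_eventually allI le nrm_nonneg)
    moreover have "?l \<in> span (insert b B)"
      using span_mono[of B "insert b B"] l(1) by (intro span_add span_scale) (auto intro: span_base)
    moreover have "strict_mono ?r" using t0(1) l(2) by (rule strict_mono_o)
    ultimately show ?thesis by blast
  qed
qed

lemma bounded_convergent_subsequence:
  assumes "\<And>j::nat. x j \<in> V" "\<And>j. nrm (x j) \<le> M"
  shows "\<exists>l\<in>V. \<exists>r. strict_mono r \<and> (\<lambda>j. nrm (x (r j) - l)) \<longlonglongrightarrow> 0"
proof -
  obtain B where "finite B" "span B = V" using fin_dim by blast
  then show ?thesis using bounded_subsequence_span[of B x M] assms span_superset by blast
qed

lemma openin_norm_topology:
  "openin (norm_topology V nrm) U \<longleftrightarrow>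
    U \<subseteq> V \<and> (\<forall>x\<in>U. \<exists>e>0. \<forall>y\<in>V. nrm (y - x) < e \<longrightarrow> y \<in> U)"
proof -
  interpret M: Metric_space V "norm_dist V nrm" by (rule Metric_space_norm_dist)
  have "M.mball x e \<subseteq> U \<longleftrightarrow> (\<forall>y\<in>V. nrm (y - x) < e \<longrightarrow> y \<in> U)" if "x \<in> V" for x e
    using that nrm_minus_commute by (auto simp: M.mball_def norm_dist_def)
  then show ?thesis
    unfolding norm_topology_def M.openin_mtopology by (metis subsetD)
qed

lemma openin_norm_ball:
  assumes "x \<in> V"
  shows "openin (norm_topology V nrm) {y \<in> V. nrm (y - x) < e}"
  unfolding openin_norm_topology
proof (intro conjI ballI)
  fix y assume y: "y \<in> {y \<in> V. nrm (y - x) < e}"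
  show "\<exists>d>0. \<forall>z\<in>V. nrm (z - y) < d \<longrightarrow> z \<in> {y \<in> V. nrm (y - x) < e}"
    using y nrm_diff_triangle[of _ y x] assms by (intro exI[of _ "e - nrm (y - x)"]) fastforce
qed auto

end

section \<open>Neighbourhoods in the product\<close>

locale normed_space_product =
  fixes V :: "nat \<Rightarrow> 'a::real_vector set" and nrm :: "nat \<Rightarrow> 'a \<Rightarrow> real" and a :: "nat \<Rightarrow> 'a"
  assumes factor: "\<And>n. fin_dim_normed_space (V n) (nrm n)"
    and nontrivial: "\<And>n. V n \<noteq> {0}"
    and base_point: "a \<in> PiE UNIV V"
begin

sublocale factor: fin_dim_normed_space "V n" "nrm n" for n
  by (rule factor)

lemma openin_V: "openin (norm_topology (V n) (nrm n)) (V n)"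
  using openin_topspace[of "norm_topology (V n) (nrm n)"] by (simp only: factor.topspace_norm_topology)

text \<open>Finitely many restricted factors allow one common radius. T is kept arbitrary to serve
  twice: \<open>UNIV\<close> for the topology of \<sigma>, finite T for near openness.\<close>

lemma openin_product_norm_topology:
  "openin (product_topology (\<lambda>n. norm_topology (V n) (nrm n)) T) S \<longleftrightarrow>
    S \<subseteq> PiE T V \<and>
    (\<forall>z\<in>S. \<exists>J e. finite J \<and> J \<subseteq> T \<and> e > 0 \<and>
      (\<forall>w\<in>PiE T V. (\<forall>i\<in>J. nrm i (w i - z i) < e) \<longrightarrow> w \<in> S))"
    (is "?open \<longleftrightarrow> _ \<and> (\<forall>z\<in>S. ?nbhd z)")
proof (intro iffI conjI ballI)
  assume opn: ?open
  show "S \<subseteq> PiE T V"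
    using openin_subset[OF opn] by (simp add: factor.topspace_norm_topology)
  fix z assume z: "z \<in> S"
  obtain U where U: "finite {i \<in> T. U i \<noteq> V i}" "\<And>i. i \<in> T \<Longrightarrow> openin (norm_topology (V i) (nrm i)) (U i)"
    "z \<in> PiE T U" "PiE T U \<subseteq> S"
    using bspec[OF opn[unfolded openin_product_topology_alt factor.topspace_norm_topology] z] by auto
  define J where "J = {i \<in> T. U i \<noteq> V i}"
  have "\<exists>e>0. \<forall>y\<in>V i. nrm i (y - z i) < e \<longrightarrow> y \<in> U i" if "i \<in> T" for i
    using bspec[OF conjunct2[OF U(2)[OF that, unfolded factor.openin_norm_topology]] PiE_mem[OF U(3) that]] .
  then obtain e where e: "\<And>i. i \<in> T \<Longrightarrow> e i > 0"
    "\<And>i y. i \<in> T \<Longrightarrow> y \<in> V i \<Longrightarrow> nrm i (y - z i) < e i \<Longrightarrow> y \<in> U i"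
    by metis
  have fin: "finite (insert 1 (e ` J))" and JT: "J \<subseteq> T" using U(1) by (auto simp: J_def)
  \<comment> \<open>The inserted 1 keeps the minimum meaningful when J is empty.\<close>
  define e0 where "e0 = Min (insert 1 (e ` J))"
  have e0: "e0 > 0" "\<And>i. i \<in> J \<Longrightarrow> e0 \<le> e i"
    using fin JT e(1) by (auto simp: e0_def)
  have "w \<in> S" if w: "w \<in> PiE T V" "\<forall>i\<in>J. nrm i (w i - z i) < e0" for w
  proof -
    have "w i \<in> U i" if i: "i \<in> T" for i
    proof (cases "i \<in> J")
      case True
      then show ?thesis using e(2)[OF i] w e0(2)[OF True] i by fastforce
    next
      case False
      then show ?thesis using i w(1) by (auto simp: J_def)
    qed
    then have "w \<in> PiE T U" using w(1) by (simp add: PiE_iff)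
    then show ?thesis using U(4) by blast
  qed
  moreover have "finite J" using U(1) by (simp add: J_def)
  ultimately show "?nbhd z" using e0(1) JT by blast
next
  assume S: "S \<subseteq> PiE T V \<and> (\<forall>z\<in>S. ?nbhd z)"
  show ?open
    unfolding openin_product_topology_alt factor.topspace_norm_topology
  proof
    fix z assume z: "z \<in> S"
    obtain J e where J: "finite J" "J \<subseteq> T" "e > 0"
      "\<forall>w\<in>PiE T V. (\<forall>i\<in>J. nrm i (w i - z i) < e) \<longrightarrow> w \<in> S"
      using bspec[OF conjunct2[OF S] z] by (elim exE conjE) (rule that)
    have zV: "z \<in> PiE T V" using S z by blast
    define U where "U i = (if i \<in> J then {y \<in> V i. nrm i (y - z i) < e} else V i)" for i
    have "openin (norm_topology (V i) (nrm i)) (U i)" if "i \<in> T" for i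
      using PiE_mem[OF zV that] by (simp add: U_def factor.openin_norm_ball openin_V)
    moreover have "finite {i \<in> T. U i \<noteq> V i}"
      by (rule finite_subset[OF _ J(1)]) (auto simp: U_def)
    moreover have "z \<in> PiE T U"
      using zV J(3) by (auto simp: U_def PiE_iff)
    moreover have "PiE T U \<subseteq> S"
    proof
      fix w assume w: "w \<in> PiE T U"
      have "w \<in> PiE T V" using w by (auto simp: U_def PiE_iff split: if_splits)
      moreover have "\<forall>i\<in>J. nrm i (w i - z i) < e"
        using w J(2) by (fastforce simp: U_def PiE_iff)
      ultimately show "w \<in> S" using J(4) by blast
    qed
    ultimately show "\<exists>U. finite {i \<in> T. U i \<noteq> V i} \<and>
        (\<forall>i\<in>T. openin (norm_topology (V i) (nrm i)) (U i)) \<and> z \<in> PiE T U \<and> PiE T U \<subseteq> S"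
      by (intro exI[of _ U]) blast
  qed
qed

section \<open>Points of \<sigma> and their coordinate distances\<close>

definition coord_dist :: "nat \<Rightarrow> (nat \<Rightarrow> 'a) \<Rightarrow> (nat \<Rightarrow> 'a) \<Rightarrow> real"
  where "coord_dist n x y = nrm n (x n - y n)"

lemma \<sigma>_coord: "x \<in> \<sigma> V a \<Longrightarrow> x n \<in> V n"
  by (auto simp: \<sigma>_def)

lemma base_in_\<sigma> [simp]: "a \<in> \<sigma> V a"
  using base_point by (simp add: \<sigma>_def)

lemma fun_upd_in_\<sigma>:
  assumes "x \<in> \<sigma> V a" "s \<in> V n" shows "x(n := s) \<in> \<sigma> V a"
proof -
  have "finite (insert n {i. x i \<noteq> a i})" using assms(1) by (simp add: \<sigma>_def)
  then have "finite {i. (x(n := s)) i \<noteq> a i}" by (rule rev_finite_subset) auto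
  then show ?thesis using assms by (auto simp: \<sigma>_def PiE_iff)
qed

lemma override_on_in_\<sigma>:
  assumes "x \<in> \<sigma> V a" "z \<in> PiE T V" "finite T" shows "override_on x z T \<in> \<sigma> V a"
proof -
  have "finite (T \<union> {i. x i \<noteq> a i})" using assms by (simp add: \<sigma>_def)
  then have "finite {i. override_on x z T i \<noteq> a i}"
    by (rule rev_finite_subset) (auto simp: override_on_def)
  then show ?thesis using assms by (auto simp: \<sigma>_def PiE_iff override_on_def)
qed

lemma override_on_\<sigma>:
  assumes "x \<in> \<sigma> V a" "y \<in> \<sigma> V a" "finite T" shows "override_on x y T \<in> \<sigma> V a"
proof -
  have "override_on x y T = override_on x (restrict y T) T" by (auto simp: override_on_def)
  then show ?thesis using override_on_in_\<sigma>[of x "restrict y T" T] assms by (auto simp: \<sigma>_coord)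
qed

lemma coord_dist_nonneg: "x \<in> \<sigma> V a \<Longrightarrow> y \<in> \<sigma> V a \<Longrightarrow> 0 \<le> coord_dist n x y"
  by (simp add: coord_dist_def factor.nrm_nonneg \<sigma>_coord factor.subspace subspace_diff)

lemma coord_dist_eq: "x n = y n \<Longrightarrow> coord_dist n x y = 0"
  by (simp add: coord_dist_def)

lemma coord_dist_commute: "x \<in> \<sigma> V a \<Longrightarrow> y \<in> \<sigma> V a \<Longrightarrow> coord_dist n x y = coord_dist n y x"
  by (simp add: coord_dist_def factor.nrm_minus_commute \<sigma>_coord)

lemma coord_dist_triangle:
  "x \<in> \<sigma> V a \<Longrightarrow> y \<in> \<sigma> V a \<Longrightarrow> z \<in> \<sigma> V a \<Longrightarrow>
    coord_dist n x z \<le> coord_dist n x y + coord_dist n y z"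
  by (simp add: coord_dist_def factor.nrm_diff_triangle \<sigma>_coord)

section \<open>Cylinders as neighbourhood bases, and continuity expressed by them\<close>

definition cylinder :: "nat \<Rightarrow> real \<Rightarrow> (nat \<Rightarrow> 'a) \<Rightarrow> (nat \<Rightarrow> 'a) set"
  where "cylinder m e u = {x \<in> \<sigma> V a. \<forall>i<m. coord_dist i x u < e}"

lemma topspace_\<sigma>_topology [simp]: "topspace (\<sigma>_topology V nrm a) = \<sigma> V a"
  by (auto simp: \<sigma>_topology_def factor.topspace_norm_topology \<sigma>_def)

lemma cylinder_in_neighbourhood:
  assumes "openin (\<sigma>_topology V nrm a) U" "u \<in> U"
  obtains m e where "e > 0" "cylinder m e u \<subseteq> U"
proof -
  obtain S where S: "openin (product_topology (\<lambda>n. norm_topology (V n) (nrm n)) UNIV) S"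
    and U: "U = S \<inter> \<sigma> V a"
    using assms(1) unfolding \<sigma>_topology_def openin_subtopology by blast
  obtain J e where J: "finite J" "e > 0"
    "\<And>w. w \<in> PiE UNIV V \<Longrightarrow> (\<forall>i\<in>J. nrm i (w i - u i) < e) \<Longrightarrow> w \<in> S"
    using bspec[OF conjunct2[OF S[unfolded openin_product_norm_topology]], of u] assms(2) U by blast
  obtain m where m: "J \<subseteq> {..<m}" using J(1) finite_nat_iff_bounded by blast
  have "cylinder m e u \<subseteq> U"
  proof
    fix x assume "x \<in> cylinder m e u"
    then have "x \<in> \<sigma> V a" "\<forall>i\<in>J. nrm i (x i - u i) < e"
      using m by (auto simp: cylinder_def coord_dist_def)
    then show "x \<in> U" unfolding U using J(3)[of x] by (simp add: \<sigma>_def)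
  qed
  with J(2) show thesis by (rule that)
qed

lemma openin_cylinder:
  assumes u: "u \<in> \<sigma> V a"
  shows "openin (\<sigma>_topology V nrm a) (cylinder m e u)"
proof -
  let ?S = "PiE UNIV (\<lambda>i. if i < m then {y \<in> V i. nrm i (y - u i) < e} else V i)"
  have "openin (product_topology (\<lambda>n. norm_topology (V n) (nrm n)) UNIV) ?S"
    unfolding openin_PiE_gen
  proof (intro disjI2 conjI ballI)
    show "finite {i \<in> UNIV. (if i < m then {y \<in> V i. nrm i (y - u i) < e} else V i)
        \<noteq> topspace (norm_topology (V i) (nrm i))}"
      by (rule finite_subset[of _ "{..<m}"]) (auto simp: factor.topspace_norm_topology)
    show "openin (norm_topology (V i) (nrm i))
        (if i < m then {y \<in> V i. nrm i (y - u i) < e} else V i)" for i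
      by (simp add: factor.openin_norm_ball \<sigma>_coord[OF u] openin_V)
  qed
  moreover have "cylinder m e u = ?S \<inter> \<sigma> V a"
    by (auto simp: cylinder_def coord_dist_def \<sigma>_coord PiE_iff split: if_splits)
  ultimately show ?thesis
    unfolding \<sigma>_topology_def openin_subtopology by blast
qed

lemma centre_in_cylinder: "u \<in> \<sigma> V a \<Longrightarrow> e > 0 \<Longrightarrow> u \<in> cylinder m e u"
  by (simp add: cylinder_def coord_dist_eq)

lemma cylinder_mono: "m' \<le> m \<Longrightarrow> e \<le> e' \<Longrightarrow> cylinder m e u \<subseteq> cylinder m' e' u"
  unfolding cylinder_def by (auto intro: less_le_trans)

lemma strongly_separately_continuous_iff:
  "strongly_separately_continuous V nrm a f \<longleftrightarrow>
    (\<forall>u\<in>\<sigma> V a. \<forall>n. \<forall>e>0. \<exists>m d. d > 0 \<and> (\<forall>x\<in>cylinder m d u. \<bar>f x - f (x(n := u n))\<bar> < e))"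
proof -
  have "((\<lambda>x. \<bar>f x - f (x(n := u n))\<bar>) \<longlongrightarrow> 0) (atin (\<sigma>_topology V nrm a) u) \<longleftrightarrow>
      (\<forall>e>0. \<exists>m d. d > 0 \<and> (\<forall>x\<in>cylinder m d u. \<bar>f x - f (x(n := u n))\<bar> < e))"
    if u: "u \<in> \<sigma> V a" for u n
  proof -
    have "eventually (\<lambda>x. \<bar>f x - f (x(n := u n))\<bar> < e) (atin (\<sigma>_topology V nrm a) u) \<longleftrightarrow>
        (\<exists>m d. d > 0 \<and> (\<forall>x\<in>cylinder m d u. \<bar>f x - f (x(n := u n))\<bar> < e))" (is "?L \<longleftrightarrow> ?R")
      if e: "e > 0" for e
    proof
      assume ?L
      then obtain U where U: "openin (\<sigma>_topology V nrm a) U" "u \<in> U"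
        "\<forall>x\<in>U - {u}. \<bar>f x - f (x(n := u n))\<bar> < e"
        unfolding eventually_atin using u by auto
      obtain m d where m: "d > 0" "cylinder m d u \<subseteq> U" using cylinder_in_neighbourhood[OF U(1,2)] by blast
      \<comment> \<open>At \<open>x = u\<close>, which the punctured filter leaves out, the
        difference is 0.\<close>
      have "\<bar>f x - f (x(n := u n))\<bar> < e" if "x \<in> cylinder m d u" for x
        using that m(2) U(3) e by (cases "x = u") auto
      with m(1) show ?R by blast
    next
      assume ?R
      then obtain m d where "d > 0" "\<forall>x\<in>cylinder m d u. \<bar>f x - f (x(n := u n))\<bar> < e" by blast
      then show ?L
        unfolding eventually_atin using openin_cylinder[OF u] centre_in_cylinder[OF u]
        by (intro disjI2 exI[of _ "cylinder m d u"]) simp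
    qed
    then show ?thesis by (simp add: tendsto_iff dist_real_def)
  qed
  then show ?thesis by (simp add: strongly_separately_continuous_def)
qed

lemma topcontinuous_at_iff:
  assumes u: "u \<in> \<sigma> V a"
  shows "topcontinuous_at (\<sigma>_topology V nrm a) euclideanreal f u \<longleftrightarrow>
    (\<forall>e>0. \<exists>m d. d > 0 \<and> (\<forall>x\<in>cylinder m d u. \<bar>f x - f u\<bar> < e))" (is "?L \<longleftrightarrow> ?R")
proof
  assume L: ?L
  show ?R
  proof (intro allI impI)
    fix e :: real assume "e > 0"
    then have "openin euclideanreal (ball (f u) e) \<and> f u \<in> ball (f u) e" by simp
    then obtain U where U: "openin (\<sigma>_topology V nrm a) U" "u \<in> U" "\<forall>x\<in>U. f x \<in> ball (f u) e"
      using L unfolding topcontinuous_at_def by meson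
    obtain m d where "d > 0" "cylinder m d u \<subseteq> U" using cylinder_in_neighbourhood[OF U(1,2)] by blast
    then show "\<exists>m d. d > 0 \<and> (\<forall>x\<in>cylinder m d u. \<bar>f x - f u\<bar> < e)"
      using U(3) by (intro exI[of _ m] exI[of _ d]) (auto simp: dist_real_def abs_minus_commute)
  qed
next
  assume R: ?R
  have "\<exists>U. openin (\<sigma>_topology V nrm a) U \<and> u \<in> U \<and> (\<forall>y\<in>U. f y \<in> S)"
    if S: "open S" "f u \<in> S" for S
  proof -
    obtain e where e: "e > 0" "ball (f u) e \<subseteq> S" by (rule openE[OF S])
    obtain m d where "d > 0" "\<forall>x\<in>cylinder m d u. \<bar>f x - f u\<bar> < e" using R e(1) by blast
    then show ?thesis
      using e(2) openin_cylinder[OF u] centre_in_cylinder[OF u]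
      by (intro exI[of _ "cylinder m d u"]) (auto simp: subset_iff dist_real_def abs_minus_commute)
  qed
  then show ?L using u by (auto simp: topcontinuous_at_def)
qed

text \<open>The map \<open>override_on a _ T\<close> identifies the product over T with the points
  of \<sigma> that agree with a off T; its inverse is \<open>restrict _ T\<close>. Openness thus
  becomes a condition on points of \<sigma> alone, and as T is finite a single radius can be imposed
  on all its coordinates.\<close>

lemma nearly_open_iff:
  assumes W: "W \<subseteq> \<sigma> V a"
  shows "nearly_open V nrm a W \<longleftrightarrow>
    (\<forall>T. finite T \<longrightarrow> (\<forall>u\<in>W. (\<forall>i. i \<notin> T \<longrightarrow> u i = a i) \<longrightarrow>
      (\<exists>e>0. \<forall>v\<in>\<sigma> V a. (\<forall>i. i \<notin> T \<longrightarrow> v i = a i) \<longrightarrow> (\<forall>i\<in>T. coord_dist i v u < e) \<longrightarrow> v \<in> W)))"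
proof -
  have "openin (product_topology (\<lambda>n. norm_topology (V n) (nrm n)) T)
          {z \<in> PiE T V. override_on a z T \<in> W} \<longleftrightarrow>
      (\<forall>u\<in>W. (\<forall>i. i \<notin> T \<longrightarrow> u i = a i) \<longrightarrow>
      (\<exists>e>0. \<forall>v\<in>\<sigma> V a. (\<forall>i. i \<notin> T \<longrightarrow> v i = a i) \<longrightarrow> (\<forall>i\<in>T. coord_dist i v u < e) \<longrightarrow> v \<in> W))"
    (is "?L \<longleftrightarrow> (\<forall>u\<in>W. _ \<longrightarrow> ?nbhd u)") if T: "finite T" for T
  proof (intro iffI ballI impI)
    fix u assume L: ?L and u: "u \<in> W" "\<forall>i. i \<notin> T \<longrightarrow> u i = a i"
    have eq: "override_on a (restrict v T) T = v" if "\<forall>i. i \<notin> T \<longrightarrow> v i = a i" for v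
      using that by (auto simp: override_on_def)
    have res: "restrict u T \<in> {z \<in> PiE T V. override_on a z T \<in> W}"
      using u W eq by (auto simp: \<sigma>_coord)
    obtain J e where J: "J \<subseteq> T" "e > 0" "\<forall>w\<in>PiE T V. (\<forall>i\<in>J. nrm i (w i - restrict u T i) < e) \<longrightarrow>
        w \<in> {z \<in> PiE T V. override_on a z T \<in> W}"
      using bspec[OF conjunct2[OF L[unfolded openin_product_norm_topology]] res]
      by (elim exE conjE) (rule that)
    have "v \<in> W" if v: "v \<in> \<sigma> V a" "\<forall>i. i \<notin> T \<longrightarrow> v i = a i" "\<forall>i\<in>T. coord_dist i v u < e" for v
    proof -
      have "restrict v T \<in> PiE T V" using v(1) by (auto simp: \<sigma>_coord)
      moreover have "\<forall>i\<in>J. nrm i (restrict v T i - restrict u T i) < e"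
        using v(3) J(1) by (auto simp: coord_dist_def)
      ultimately show ?thesis using J(3) eq[OF v(2)] by fastforce
    qed
    with J(2) show "?nbhd u" by blast
  next
    assume R: "\<forall>u\<in>W. (\<forall>i. i \<notin> T \<longrightarrow> u i = a i) \<longrightarrow> ?nbhd u"
    show ?L
      unfolding openin_product_norm_topology
    proof (intro conjI ballI)
      fix z assume z: "z \<in> {z \<in> PiE T V. override_on a z T \<in> W}"
      have "override_on a z T \<in> W" "\<forall>i. i \<notin> T \<longrightarrow> override_on a z T i = a i" using z by auto
      from R[THEN bspec, OF this(1), THEN mp, OF this(2)] obtain e where e: "e > 0" "\<And>v. v \<in> \<sigma> V a \<Longrightarrow>
          (\<forall>i. i \<notin> T \<longrightarrow> v i = a i) \<Longrightarrow> (\<forall>i\<in>T. coord_dist i v (override_on a z T) < e) \<Longrightarrow> v \<in> W"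
        by blast
      have "override_on a w T \<in> W" if "w \<in> PiE T V" "\<forall>i\<in>T. nrm i (w i - z i) < e" for w
        using that override_on_in_\<sigma>[OF base_in_\<sigma> _ T] by (intro e(2)) (auto simp: coord_dist_def)
      then show "\<exists>J e. finite J \<and> J \<subseteq> T \<and> e > 0 \<and> (\<forall>w\<in>PiE T V. (\<forall>i\<in>J. nrm i (w i - z i) < e) \<longrightarrow>
          w \<in> {z \<in> PiE T V. override_on a z T \<in> W})"
        using T e(1) by blast
    qed auto
  qed
  then show ?thesis using W by (simp add: nearly_open_def)
qed

section \<open>Discontinuity sets are nearly open\<close>

lemma strongly_separately_continuous_override:
  assumes f: "strongly_separately_continuous V nrm a f" and u: "u \<in> \<sigma> V a"
    and T: "finite T" and e: "e > 0"
  shows "\<exists>m d. d > 0 \<and> (\<forall>x\<in>cylinder m d u. \<bar>f x - f (override_on x u T)\<bar> < e)"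
  using T e
proof (induction T arbitrary: e rule: finite_induct)
  case empty
  then show ?case by (intro exI[of _ 0] exI[of _ 1]) simp
next
  case (insert n T)
  obtain m d where m: "d > 0" "\<forall>x\<in>cylinder m d u. \<bar>f x - f (override_on x u T)\<bar> < e / 2"
    using insert.IH[of "e / 2"] insert.prems by auto
  obtain m' d' where m': "d' > 0" "\<forall>x\<in>cylinder m' d' u. \<bar>f x - f (x(n := u n))\<bar> < e / 2"
    using f u insert.prems unfolding strongly_separately_continuous_iff by (meson half_gt_zero)
  have "\<bar>f x - f (override_on x u (insert n T))\<bar> < e" if x: "x \<in> cylinder (max m m') (min d d') u" for x
  proof -
    have "x \<in> cylinder m d u" "x \<in> cylinder m' d' u"
      by (rule subsetD[OF cylinder_mono x], simp, simp)+
    \<comment> \<open>Resetting coordinates to those of u never leaves a cylinder around u. So after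
      T has been reset, separate continuity at u still applies to the resulting point in coordinate
      n.\<close>
    moreover from this(2) have "override_on x u T \<in> cylinder m' d' u"
      using override_on_\<sigma>[OF _ u insert.hyps(1)] m'(1)
      by (auto simp: cylinder_def coord_dist_def override_on_def)
    moreover have "override_on x u (insert n T) = (override_on x u T)(n := u n)"
      by (auto simp: override_on_def)
    ultimately show ?thesis using m(2) m'(2) by (smt (verit) field_sum_of_halves)
  qed
  then show ?case using m(1) m'(1) by (meson min_less_iff_conj)
qed

lemma nearly_open_discontinuity_set:
  assumes f: "strongly_separately_continuous V nrm a f"
  shows "nearly_open V nrm a (discontinuity_set V nrm a f)"
proof -
  let ?D = "discontinuity_set V nrm a f"
  have D: "x \<in> ?D \<longleftrightarrow> x \<in> \<sigma> V a \<and> (\<exists>e>0. \<forall>m d. d > 0 \<longrightarrow> (\<exists>y\<in>cylinder m d x. e \<le> \<bar>f y - f x\<bar>))" for x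
  proof (cases "x \<in> \<sigma> V a")
    case True
    then show ?thesis
      unfolding discontinuity_set_def mem_Collect_eq topcontinuous_at_iff[OF True] not_less[symmetric]
      by blast
  qed (simp add: discontinuity_set_def)
  have "\<exists>e>0. \<forall>v\<in>\<sigma> V a. (\<forall>i. i \<notin> T \<longrightarrow> v i = a i) \<longrightarrow> (\<forall>i\<in>T. coord_dist i v u < e) \<longrightarrow> v \<in> ?D"
    if T: "finite T" and uD: "u \<in> ?D" and uT: "\<forall>i. i \<notin> T \<longrightarrow> u i = a i" for T u
  proof -
    have u: "u \<in> \<sigma> V a" using uD D by blast
    obtain e where e: "e > 0" "\<And>m d. d > 0 \<Longrightarrow> \<exists>y\<in>cylinder m d u. e \<le> \<bar>f y - f u\<bar>"
      using uD D by meson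
    obtain m d where m: "d > 0" "\<And>x. x \<in> cylinder m d u \<Longrightarrow> \<bar>f x - f (override_on x u T)\<bar> < e / 4"
      using strongly_separately_continuous_override[OF f u T, of "e / 4"] e(1) by auto
    \<comment> \<open>From a jump of size e at u, three errors below \<open>e / 4\<close> are lost:
      at y, at y' and at v, each compared with its reset to u on T. A jump of \<open>e / 4\<close>
      remains at v.\<close>
    have "v \<in> ?D" if v: "v \<in> \<sigma> V a" "\<forall>i. i \<notin> T \<longrightarrow> v i = a i" "\<forall>i\<in>T. coord_dist i v u < d" for v
      unfolding D
    proof (intro conjI v(1) exI[of _ "e / 4"] allI impI)
      fix m' and d' :: real assume d': "d' > 0"
      obtain y where y: "y \<in> cylinder (max m m') (min d d') u" "e \<le> \<bar>f y - f u\<bar>"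
        using e(2)[of "min d d'" "max m m'"] d' m(1) by auto
      \<comment> \<open>y' follows v on T and y off T, so it is as close to v as y is to u.
        Resetting T to u sends y and y' to the same point, which links \<open>f y'\<close> to
        \<open>f y\<close>.\<close>
      define y' where "y' = override_on y v T"
      have y\<sigma>: "y \<in> \<sigma> V a" "y \<in> cylinder m d u" using y(1) by (auto simp: cylinder_def)
      have y': "y' \<in> \<sigma> V a" unfolding y'_def by (rule override_on_\<sigma>[OF y\<sigma>(1) v(1) T])
      have off: "v i = u i" if "i \<notin> T" for i using that v(2) uT by simp
      have "coord_dist i y' v < d'" if "i < m'" for i
        using that y(1) d' off[of i] by (cases "i \<in> T") (auto simp: y'_def cylinder_def coord_dist_def)
      then have "y' \<in> cylinder m' d' v" using y' by (simp add: cylinder_def)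
      moreover have "coord_dist i y' u < d" if "i < m" for i
        using that y(1) v(3) off[of i] by (cases "i \<in> T") (auto simp: y'_def cylinder_def coord_dist_def)
      then have "y' \<in> cylinder m d u" using y' by (simp add: cylinder_def)
      moreover have "v \<in> cylinder m d u"
      proof -
        have "coord_dist i v u < d" for i
          using v(3) off[of i] m(1) by (cases "i \<in> T") (auto simp: coord_dist_def)
        then show ?thesis using v(1) by (simp add: cylinder_def)
      qed
      moreover have "override_on y' u T = override_on y u T" "override_on v u T = u"
        using v(2) uT by (auto simp: y'_def override_on_def)
      ultimately have "\<bar>f y' - f (override_on y u T)\<bar> < e / 4" "\<bar>f v - f u\<bar> < e / 4"
        using m(2)[of y'] m(2)[of v] by simp_all
      then have "e / 4 \<le> \<bar>f y' - f v\<bar>" using m(2)[OF y\<sigma>(2)] y(2) by linarith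
      with \<open>y' \<in> cylinder m' d' v\<close> show "\<exists>y\<in>cylinder m' d' v. e / 4 \<le> \<bar>f y - f v\<bar>" by blast
    qed (use e(1) in simp)
    with m(1) show ?thesis by blast
  qed
  then show ?thesis
    by (subst nearly_open_iff) (auto simp: discontinuity_set_def)
qed

section \<open>Boxes inside slicewise open sets\<close>

text \<open>A copy of the product of the first n spaces. These copies increase with n and exhaust
  \<sigma>.\<close>

definition slice :: "nat \<Rightarrow> (nat \<Rightarrow> 'a) set"
  where "slice n = {x \<in> \<sigma> V a. \<forall>i\<ge>n. x i = a i}"

lemma slice_\<sigma>: "x \<in> slice n \<Longrightarrow> x \<in> \<sigma> V a"
  by (simp add: slice_def)

lemma slice_mono: "m \<le> n \<Longrightarrow> slice m \<subseteq> slice n"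
  by (auto simp: slice_def)

lemma \<sigma>_in_slice:
  assumes "x \<in> \<sigma> V a" obtains n where "x \<in> slice n"
proof -
  obtain n where "{i. x i \<noteq> a i} \<subseteq> {..<n}"
    using assms finite_nat_iff_bounded by (auto simp: \<sigma>_def)
  then have "x \<in> slice n" using assms by (fastforce simp: slice_def)
  then show thesis by (rule that)
qed

lemma truncation_in_slice: "x \<in> \<sigma> V a \<Longrightarrow> override_on a x {..<n} \<in> slice n"
  by (simp add: slice_def override_on_\<sigma>)

text \<open>Successive subsequences, one for each of the finitely many coordinates below n; from n
  on, all points agree with a.\<close>

lemma bounded_subsequence_slice:
  assumes z: "\<And>j::nat. z j \<in> slice n" and B: "\<And>i j. i < n \<Longrightarrow> coord_dist i (z j) a \<le> B"
  shows "\<exists>l\<in>slice n. \<exists>r. strict_mono r \<and> (\<forall>i. (\<lambda>j. coord_dist i (z (r j)) l) \<longlonglongrightarrow> 0)"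
proof -
  have "\<exists>l r. strict_mono r \<and> (\<forall>i<m. l i \<in> V i \<and> (\<lambda>j. nrm i (z (r j) i - l i)) \<longlonglongrightarrow> 0)"
    if "m \<le> n" for m
    using that
  proof (induction m)
    case 0
    show ?case by (intro exI[of _ a] exI[of _ "\<lambda>j. j"]) (simp add: strict_mono_def)
  next
    case (Suc m)
    then obtain l r where l: "strict_mono r"
      "\<And>i. i < m \<Longrightarrow> l i \<in> V i" "\<And>i. i < m \<Longrightarrow> (\<lambda>j. nrm i (z (r j) i - l i)) \<longlonglongrightarrow> 0"
      by auto
    \<comment> \<open>The bound B is relative to a, so compactness is applied to the differences
      from a, and the limit p is shifted back to \<open>a m + p\<close>.\<close>
    define x where "x j = z (r j) m - a m" for j
    have "x j \<in> V m" for j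
      using \<sigma>_coord[OF slice_\<sigma>[OF z]] \<sigma>_coord[OF base_in_\<sigma>]
      by (simp add: x_def factor.subspace subspace_diff)
    moreover have "nrm m (x j) \<le> B" for j
      using B[of m "r j"] Suc.prems by (simp add: x_def coord_dist_def)
    ultimately obtain p s where p: "p \<in> V m" "strict_mono s" "(\<lambda>j. nrm m (x (s j) - p)) \<longlonglongrightarrow> 0"
      using factor.bounded_convergent_subsequence[of x m B] by blast
    let ?l = "l(m := a m + p)"
    have "?l i \<in> V i \<and> (\<lambda>j. nrm i (z (r (s j)) i - ?l i)) \<longlonglongrightarrow> 0" if "i < Suc m" for i
    proof (cases "i = m")
      case True
      then show ?thesis
        using p \<sigma>_coord[OF base_in_\<sigma>] by (simp add: x_def factor.subspace subspace_add diff_diff_eq)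
    next
      case False
      then have "i < m" using that by simp
      then show ?thesis
        using l(2) LIMSEQ_subseq_LIMSEQ[OF l(3) p(2)] by (simp add: o_def)
    qed
    moreover have "strict_mono (\<lambda>j. r (s j))"
      using strict_mono_o[OF l(1) p(2)] by (simp add: o_def)
    ultimately show ?case by (intro exI[of _ ?l] exI[of _ "\<lambda>j. r (s j)"]) blast
  qed
  then obtain l r where l: "strict_mono r"
    "\<And>i. i < n \<Longrightarrow> l i \<in> V i" "\<And>i. i < n \<Longrightarrow> (\<lambda>j. nrm i (z (r j) i - l i)) \<longlonglongrightarrow> 0"
    by blast
  let ?l = "override_on a (restrict l {..<n}) {..<n}"
  have "restrict l {..<n} \<in> PiE {..<n} V" using l(2) by simp
  then have "?l \<in> slice n"
    using override_on_in_\<sigma>[OF base_in_\<sigma>] by (simp add: slice_def)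
  moreover have "(\<lambda>j. coord_dist i (z (r j)) ?l) \<longlonglongrightarrow> 0" for i
  proof (cases "i < n")
    case True
    then show ?thesis using l(3) by (simp add: coord_dist_def)
  next
    case False
    then have "coord_dist i (z (r j)) ?l = 0" for j
      using z[of "r j"] by (simp add: coord_dist_def slice_def)
    then show ?thesis by simp
  qed
  ultimately show ?thesis using l(1) by blast
qed

section \<open>Relatively compact parts of a slicewise open set\<close>

definition slicewise_open :: "(nat \<Rightarrow> 'a) set \<Rightarrow> bool"
  where "slicewise_open W \<longleftrightarrow> (\<forall>n. \<forall>u\<in>W \<inter> slice n.
    \<exists>e>0. \<forall>v\<in>slice n. (\<forall>i<n. coord_dist i v u < e) \<longrightarrow> v \<in> W)"

lemma nearly_open_imp_slicewise_open:
  assumes "nearly_open V nrm a W"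
  shows "slicewise_open W"
  unfolding slicewise_open_def
proof (intro allI ballI)
  fix n u assume u: "u \<in> W \<inter> slice n"
  have "W \<subseteq> \<sigma> V a" using assms by (simp add: nearly_open_def)
  from assms[unfolded nearly_open_iff[OF this], rule_format, of "{..<n}" u]
  obtain e where "e > 0" "\<And>v. v \<in> \<sigma> V a \<Longrightarrow> (\<And>i. i \<notin> {..<n} \<Longrightarrow> v i = a i) \<Longrightarrow>
      (\<And>i. i \<in> {..<n} \<Longrightarrow> coord_dist i v u < e) \<Longrightarrow> v \<in> W"
    using u by (force simp: slice_def)
  then show "\<exists>e>0. \<forall>v\<in>slice n. (\<forall>i<n. coord_dist i v u < e) \<longrightarrow> v \<in> W"
    by (intro exI[of _ e]) (simp add: slice_def)
qed

text \<open>Stands for: C has compact closure contained in \<open>W \<inter> slice n\<close>.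
  Boundedness and a uniform radius express this without closures, and both pass easily to subsets,
  finite unions and thickenings.\<close>

definition uniformly_inside :: "(nat \<Rightarrow> 'a) set \<Rightarrow> nat \<Rightarrow> (nat \<Rightarrow> 'a) set \<Rightarrow> bool"
  where "uniformly_inside W n C \<longleftrightarrow> C \<subseteq> slice n \<and>
    (\<exists>B. \<forall>x\<in>C. \<forall>i<n. coord_dist i x a \<le> B) \<and>
    (\<exists>e>0. \<forall>x\<in>C. \<forall>y\<in>slice n. (\<forall>i<n. coord_dist i y x < e) \<longrightarrow> y \<in> W)"

lemma uniformly_inside_subset: "uniformly_inside W n C \<Longrightarrow> C' \<subseteq> C \<Longrightarrow> uniformly_inside W n C'"
  unfolding uniformly_inside_def by (meson subset_iff)

lemma uniformly_inside_imp_subset: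
  assumes "uniformly_inside W n C" shows "C \<subseteq> W"
proof
  fix x assume x: "x \<in> C"
  obtain e where "e > 0" "\<forall>x\<in>C. \<forall>y\<in>slice n. (\<forall>i<n. coord_dist i y x < e) \<longrightarrow> y \<in> W"
    using assms unfolding uniformly_inside_def by blast
  then show "x \<in> W" using x assms unfolding uniformly_inside_def by (auto simp: coord_dist_eq)
qed

lemma uniformly_inside_empty: "uniformly_inside W n {}"
  by (simp add: uniformly_inside_def exI[of _ "1::real"])

lemma uniformly_inside_Un:
  assumes "uniformly_inside W n C" "uniformly_inside W n D"
  shows "uniformly_inside W n (C \<union> D)"
proof -
  obtain B e where C: "C \<subseteq> slice n" "\<forall>x\<in>C. \<forall>i<n. coord_dist i x a \<le> B" "e > 0"
    "\<forall>x\<in>C. \<forall>y\<in>slice n. (\<forall>i<n. coord_dist i y x < e) \<longrightarrow> y \<in> W"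
    using assms(1) unfolding uniformly_inside_def by blast
  obtain B' e' where D: "D \<subseteq> slice n" "\<forall>x\<in>D. \<forall>i<n. coord_dist i x a \<le> B'" "e' > 0"
    "\<forall>x\<in>D. \<forall>y\<in>slice n. (\<forall>i<n. coord_dist i y x < e') \<longrightarrow> y \<in> W"
    using assms(2) unfolding uniformly_inside_def by blast
  have "\<forall>x\<in>C \<union> D. \<forall>i<n. coord_dist i x a \<le> max B B'"
    using C(2) D(2) by (auto simp: le_max_iff_disj)
  moreover have "\<forall>x\<in>C \<union> D. \<forall>y\<in>slice n. (\<forall>i<n. coord_dist i y x < min e e') \<longrightarrow> y \<in> W"
    using C(4) D(4) by auto
  moreover have "min e e' > 0" using C(3) D(3) by simp
  ultimately show ?thesis using C(1) D(1) unfolding uniformly_inside_def by blast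
qed

lemma uniformly_inside_UN:
  "finite I \<Longrightarrow> (\<And>i. i \<in> I \<Longrightarrow> uniformly_inside W n (C i)) \<Longrightarrow> uniformly_inside W n (\<Union>i\<in>I. C i)"
  by (induction I rule: finite_induct) (auto simp: uniformly_inside_empty intro: uniformly_inside_Un)

text \<open>This is where compactness, that is, finite dimension, enters.\<close>

lemma uniformly_inside_radius_Suc:
  assumes W: "slicewise_open W" and C: "uniformly_inside W n C"
  shows "\<exists>e>0. \<forall>x\<in>C. \<forall>y\<in>slice (Suc n). (\<forall>i<Suc n. coord_dist i y x < e) \<longrightarrow> y \<in> W"
proof (rule ccontr)
  assume "\<not> ?thesis"
  then have "\<exists>x y. x \<in> C \<and> y \<in> slice (Suc n) \<and> y \<notin> W \<and>
      (\<forall>i<Suc n. coord_dist i y x < inverse (real (Suc j)))" for j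
    by (metis inverse_positive_iff_positive of_nat_0_less_iff zero_less_Suc)
  then obtain x y where x: "\<And>j. x j \<in> C" and y: "\<And>j. y j \<in> slice (Suc n)" "\<And>j. y j \<notin> W"
    and xy: "\<And>i j. i < Suc n \<Longrightarrow> coord_dist i (y j) (x j) < inverse (real (Suc j))"
    by metis
  obtain B e where CB: "C \<subseteq> slice n" "\<forall>x\<in>C. \<forall>i<n. coord_dist i x a \<le> B" "e > 0"
    "\<forall>x\<in>C. \<forall>y\<in>slice n. (\<forall>i<n. coord_dist i y x < e) \<longrightarrow> y \<in> W"
    using C unfolding uniformly_inside_def by blast
  obtain l r where l: "l \<in> slice n" "strict_mono r" "\<And>i. (\<lambda>j. coord_dist i (x (r j)) l) \<longlonglongrightarrow> 0"
    using bounded_subsequence_slice[of x n B] x CB(1,2) by blast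
  have close: "\<forall>\<^sub>F j in sequentially. \<forall>i\<in>{..<m}. coord_dist i (x (r j)) l < d" if "d > 0" for d m
    using order_tendstoD(2)[OF l(3) that] by (intro eventually_ball_finite) simp_all
  have x\<sigma>: "x j \<in> slice n" for j using x CB(1) by blast
  \<comment> \<open>The uniform radius in \<open>slice n\<close> puts the limit l into W. Openness
    of W in \<open>slice (Suc n)\<close> at l then captures \<open>y (r j)\<close> for some large j,
    contradicting \<open>y j \<notin> W\<close>.\<close>
  have "l \<in> W"
  proof -
    obtain j where "\<forall>i\<in>{..<n}. coord_dist i (x (r j)) l < e"
      using eventually_happens[OF close[OF CB(3)]] by auto
    then have "\<forall>i<n. coord_dist i l (x (r j)) < e"
      using coord_dist_commute[OF slice_\<sigma>[OF l(1)] slice_\<sigma>[OF x\<sigma>]] by simp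
    then show ?thesis using CB(4) x l(1) by blast
  qed
  moreover have l': "l \<in> slice (Suc n)" using l(1) slice_mono[of n "Suc n"] by auto
  ultimately obtain d where d: "d > 0" "\<And>v. v \<in> slice (Suc n) \<Longrightarrow>
      (\<forall>i<Suc n. coord_dist i v l < d) \<Longrightarrow> v \<in> W"
    using W unfolding slicewise_open_def by (metis IntI)
  have "\<forall>\<^sub>F j in sequentially. inverse (real (Suc (r j))) < d / 2"
    using order_tendstoD(2)[OF LIMSEQ_subseq_LIMSEQ[OF LIMSEQ_inverse_real_of_nat l(2)], of "d / 2"] d(1)
    by (simp add: o_def)
  moreover have "\<forall>\<^sub>F j in sequentially. \<forall>i\<in>{..<Suc n}. coord_dist i (x (r j)) l < d / 2"
    using d(1) by (intro close) simp
  ultimately have "\<forall>\<^sub>F j in sequentially. inverse (real (Suc (r j))) < d / 2 \<and>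
      (\<forall>i\<in>{..<Suc n}. coord_dist i (x (r j)) l < d / 2)"
    by (rule eventually_conj)
  then obtain j where j: "inverse (real (Suc (r j))) < d / 2"
    "\<And>i. i < Suc n \<Longrightarrow> coord_dist i (x (r j)) l < d / 2"
    using eventually_happens by fastforce
  have "coord_dist i (y (r j)) l < d" if "i < Suc n" for i
    using coord_dist_triangle[OF slice_\<sigma>[OF y(1)] slice_\<sigma>[OF x\<sigma>] slice_\<sigma>[OF l'], of i "r j" "r j"]
      xy[OF that, of "r j"] j that by fastforce
  then show False using d(2)[OF y(1)] y(2) by blast
qed

text \<open>The radius e available in the next slice is shared: thickening by at most half of it
  leaves the other half as a uniform radius.\<close>

lemma uniformly_inside_thicken:
  assumes W: "slicewise_open W" and C: "uniformly_inside W n C"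
  shows "\<exists>d>0. d \<le> 1 \<and> uniformly_inside W (Suc n)
    {y \<in> slice (Suc n). \<exists>x\<in>C. \<forall>i<Suc n. coord_dist i y x \<le> d}"
proof -
  obtain e where e: "e > 0"
    "\<And>x y. x \<in> C \<Longrightarrow> y \<in> slice (Suc n) \<Longrightarrow> (\<forall>i<Suc n. coord_dist i y x < e) \<Longrightarrow> y \<in> W"
    using uniformly_inside_radius_Suc[OF W C] by blast
  obtain B where B: "C \<subseteq> slice n" "\<And>x i. x \<in> C \<Longrightarrow> i < n \<Longrightarrow> coord_dist i x a \<le> B"
    using C unfolding uniformly_inside_def by blast
  define d where "d = min 1 (e / 2)"
  have d: "d > 0" "d \<le> 1" "d + e / 2 \<le> e" using e(1) by (auto simp: d_def)
  let ?D = "{y \<in> slice (Suc n). \<exists>x\<in>C. \<forall>i<Suc n. coord_dist i y x \<le> d}"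
  \<comment> \<open>In the new coordinate n, points of C agree with a; the 0 in
    \<open>max B 0\<close> covers this, since B may be negative when \<open>n = 0\<close>. The
    summand 1 pays for the thickening.\<close>
  have "coord_dist i y a \<le> max B 0 + 1" if y: "y \<in> ?D" and i: "i < Suc n" for y i
  proof -
    obtain x where x: "x \<in> C" "coord_dist i y x \<le> d" using y i by blast
    have xn: "x \<in> slice n" using x(1) B(1) by blast
    have "coord_dist i x a \<le> max B 0"
      using B(2)[OF x(1), of i] xn i by (cases "i < n") (auto simp: slice_def coord_dist_eq)
    then show ?thesis
      using coord_dist_triangle[OF slice_\<sigma> slice_\<sigma>[OF xn] base_in_\<sigma>, of y "Suc n" i] y x(2) d(2)
      by fastforce
  qed
  moreover have "z \<in> W" if y: "y \<in> ?D" and z: "z \<in> slice (Suc n)"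
      "\<forall>i<Suc n. coord_dist i z y < e / 2" for y z
  proof -
    obtain x where x: "x \<in> C" "\<And>i. i < Suc n \<Longrightarrow> coord_dist i y x \<le> d" using y by blast
    have xn: "x \<in> slice n" using x(1) B(1) by blast
    have yn: "y \<in> slice (Suc n)" using y by blast
    have "coord_dist i z x < e" if "i < Suc n" for i
      using coord_dist_triangle[OF slice_\<sigma>[OF z(1)] slice_\<sigma>[OF yn] slice_\<sigma>[OF xn], of i]
        z(2) x(2)[OF that] that d(3) by fastforce
    then show ?thesis using e(2)[OF x(1) z(1)] by blast
  qed
  ultimately have "uniformly_inside W (Suc n) ?D"
    unfolding uniformly_inside_def using e(1)
    by (intro conjI exI[of _ "max B 0 + 1"] exI[of _ "e / 2"]) auto
  with d(1,2) show ?thesis by blast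
qed

text \<open>Not a formal monotonicity: the radius has to work in the larger slice, where more points
  compete. It is renewed one coordinate at a time by thickening, and C lies in each of its
  thickenings.\<close>

lemma uniformly_inside_mono:
  assumes W: "slicewise_open W" and C: "uniformly_inside W m C" and "m \<le> n"
  shows "uniformly_inside W n C"
  using \<open>m \<le> n\<close>
proof (induction n rule: dec_induct)
  case base
  then show ?case by (rule C)
next
  case (step n)
  obtain d where d: "d > 0" "uniformly_inside W (Suc n)
      {y \<in> slice (Suc n). \<exists>x\<in>C. \<forall>i<Suc n. coord_dist i y x \<le> d}"
    using uniformly_inside_thicken[OF W step.IH] by blast
  have "C \<subseteq> slice (Suc n)"
    using step.IH slice_mono[of n "Suc n"] unfolding uniformly_inside_def by auto
  then have "C \<subseteq> {y \<in> slice (Suc n). \<exists>x\<in>C. \<forall>i<Suc n. coord_dist i y x \<le> d}"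
    using d(1) by (force simp: coord_dist_eq)
  with d(2) show ?case by (rule uniformly_inside_subset)
qed

section \<open>Exhaustion by cores and the choice of the box sizes\<close>

definition core :: "(nat \<Rightarrow> 'a) set \<Rightarrow> nat \<Rightarrow> nat \<Rightarrow> (nat \<Rightarrow> 'a) set"
  where "core W k j = {x \<in> slice k. (\<forall>i<k. coord_dist i x a \<le> real j) \<and>
    (\<forall>y\<in>slice k. (\<forall>i<k. coord_dist i y x < inverse (real (Suc j))) \<longrightarrow> y \<in> W)}"

lemma uniformly_inside_core: "uniformly_inside W k (core W k j)"
  unfolding uniformly_inside_def
  by (intro conjI exI[of _ "real j"] exI[of _ "inverse (real (Suc j))"]) (auto simp: core_def)

text \<open>The cores exhaust \<open>W \<inter> slice k\<close>: as j grows, the bound j exceeds the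
  size of x, and the margin 1/(j+1) drops below a radius of x in W.\<close>

lemma eventually_in_core:
  assumes W: "slicewise_open W" and x: "x \<in> W" "x \<in> slice k"
  shows "\<forall>\<^sub>F j in sequentially. x \<in> core W k j"
proof -
  obtain e where e: "e > 0" "\<And>v. v \<in> slice k \<Longrightarrow> (\<forall>i<k. coord_dist i v x < e) \<Longrightarrow> v \<in> W"
    using W x unfolding slicewise_open_def by (metis IntI)
  have "\<forall>\<^sub>F j in sequentially. \<forall>i\<in>{..<k}. coord_dist i x a \<le> real j"
    by (intro eventually_ball_finite)
      (auto intro: eventually_compose_filterlim[OF eventually_ge_at_top filterlim_real_sequentially])
  moreover have "\<forall>\<^sub>F j in sequentially. inverse (real (Suc j)) < e"
    using order_tendstoD(2)[OF LIMSEQ_inverse_real_of_nat e(1)] .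
  ultimately show ?thesis
  proof eventually_elim
    case (elim j)
    then show ?case using x(2) e(2) by (fastforce simp: core_def)
  qed
qed

text \<open>Sets \<open>C n\<close> uniformly inside W are chosen recursively so that
  \<open>C (Suc n)\<close> contains the thickening of \<open>C n\<close> by \<open>d n\<close> in
  the next slice. Adding the cores makes every point of W enter some \<open>C n\<close>; from there
  on, a nearby y is followed through its truncations, each new coordinate i using up the tolerance
  \<open>d i\<close>.\<close>

lemma box_neighbourhoods:
  assumes W: "slicewise_open W" and W\<sigma>: "W \<subseteq> \<sigma> V a"
  obtains d where "\<And>n. 0 < d n" "\<And>n. d n \<le> 1"
    "\<And>x. x \<in> W \<Longrightarrow> \<exists>c>0. \<forall>y\<in>\<sigma> V a. (\<forall>i. coord_dist i y x < c * d i) \<longrightarrow> y \<in> W"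
proof -
  \<comment> \<open>The radius stays hidden in \<open>?Q\<close>: dependent choice produces the sets
    \<open>C n\<close>, and the radii \<open>d n\<close> are selected afterwards.\<close>
  let ?Q = "\<lambda>n C C'. \<exists>d>0. d \<le> 1 \<and>
      {y \<in> slice (Suc n). \<exists>x\<in>C. \<forall>i<Suc n. coord_dist i y x \<le> d} \<subseteq> C' \<and>
      (\<Union>k\<le>Suc n. core W k (Suc n)) \<subseteq> C'"
  have step: "\<exists>C'. uniformly_inside W (Suc n) C' \<and> ?Q n C C'"
    if C: "uniformly_inside W n C" for n C
  proof -
    obtain d where d: "d > 0" "d \<le> 1" "uniformly_inside W (Suc n)
        {y \<in> slice (Suc n). \<exists>x\<in>C. \<forall>i<Suc n. coord_dist i y x \<le> d}" (is "uniformly_inside _ _ ?D")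
      using uniformly_inside_thicken[OF W C] by blast
    have "uniformly_inside W (Suc n) (\<Union>k\<le>Suc n. core W k (Suc n))"
      using uniformly_inside_mono[OF W uniformly_inside_core] by (intro uniformly_inside_UN) auto
    then have "uniformly_inside W (Suc n) (?D \<union> (\<Union>k\<le>Suc n. core W k (Suc n)))"
      by (rule uniformly_inside_Un[OF d(3)])
    with d(1,2) show ?thesis by blast
  qed
  have "\<exists>C. \<forall>n. uniformly_inside W n (C n) \<and> ?Q n (C n) (C (Suc n))"
    by (rule dependent_nat_choice) (use uniformly_inside_empty step in blast)+
  then obtain C where C: "\<And>n. uniformly_inside W n (C n)" and Q: "\<And>n. ?Q n (C n) (C (Suc n))"
    by blast
  obtain d where D: "\<forall>n. 0 < d n \<and> d n \<le> 1 \<and>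
      {y \<in> slice (Suc n). \<exists>x\<in>C n. \<forall>i<Suc n. coord_dist i y x \<le> d n} \<subseteq> C (Suc n) \<and>
      (\<Union>k\<le>Suc n. core W k (Suc n)) \<subseteq> C (Suc n)"
    using choice[OF allI[OF Q]] by (rule exE)
  have d: "0 < d n" "d n \<le> 1" for n using D by simp_all
  note thick = spec[OF D, THEN conjunct2, THEN conjunct2, THEN conjunct1]
  note core = spec[OF D, THEN conjunct2, THEN conjunct2, THEN conjunct2]
  have "\<exists>c>0. \<forall>y\<in>\<sigma> V a. (\<forall>i. coord_dist i y x < c * d i) \<longrightarrow> y \<in> W" if x: "x \<in> W" for x
  proof -
    obtain k where k: "x \<in> slice k" by (rule \<sigma>_in_slice[OF subsetD[OF W\<sigma> x]])
    \<comment> \<open>Beyond k, the points x and a agree. The bound \<open>Suc k\<close> also makes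
      the stage a successor whose union of cores includes index k.\<close>
    have "\<forall>\<^sub>F j in sequentially. x \<in> core W k j \<and> Suc k \<le> j"
      by (intro eventually_conj eventually_in_core[OF W x k] eventually_ge_at_top)
    then obtain N' where N': "x \<in> core W k N'" "Suc k \<le> N'"
      using eventually_happens by fastforce
    then obtain N where N: "N' = Suc N" by (cases N') auto
    have xC: "x \<in> C N'"
      unfolding N by (rule subsetD[OF core UN_I[of k]]) (use N' N in auto)
    \<comment> \<open>The witness is \<open>c = d N'\<close>. As all d are at most 1, the product
      \<open>d N' * d i\<close> is below both factors: \<open>d N'\<close> serves the first
      \<open>Suc N'\<close> coordinates together, \<open>d i\<close> each later coordinate
      i.\<close>
    have "y \<in> W" if y: "y \<in> \<sigma> V a" "\<And>i. coord_dist i y x < d N' * d i" for y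
    proof -
      have close: "coord_dist i y x \<le> d N'" "coord_dist i y x \<le> d i" for i
        using y(2)[of i] mult_left_le[of "d i" "d N'"] mult_left_le_one_le[of "d i" "d N'"]
          less_imp_le[OF d(1)] d(2) by (meson less_imp_le order.trans)+
      let ?t = "\<lambda>n. override_on a y {..<n}"
      have "?t n \<in> C n" if "Suc N' \<le> n" for n
        using that
      proof (induction n rule: dec_induct)
        case base
        have "\<forall>i<Suc N'. coord_dist i (?t (Suc N')) x \<le> d N'"
          using close(1) by (simp add: coord_dist_def)
        then show ?case using truncation_in_slice[OF y(1)] xC thick[of N'] by blast
      next
        case (step n)
        \<comment> \<open>Only coordinate n changes, and it starts from \<open>a n\<close>, which
          equals \<open>x n\<close>; so the change is the deviation of y from x.\<close>
        have "coord_dist i (?t (Suc n)) (?t n) \<le> d n" if "i < Suc n" for i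
        proof (cases "i < n")
          case True
          then show ?thesis using d(1)[of n] by (simp add: coord_dist_eq less_imp_le)
        next
          case False
          then have "i = n" using that by simp
          moreover have "a n = x n" using k N'(2) step.hyps(1) by (simp add: slice_def)
          ultimately show ?thesis using close(2)[of n] by (simp add: coord_dist_def)
        qed
        then show ?case using truncation_in_slice[OF y(1)] step.IH thick[of n] by blast
      qed
      moreover obtain m where m: "y \<in> slice m" by (rule \<sigma>_in_slice[OF y(1)])
      \<comment> \<open>A point of \<sigma> equals its truncations from some index on.\<close>
      moreover have "?t (max m (Suc N')) = y"
        using m by (auto simp: override_on_def slice_def)
      ultimately have "y \<in> C (max m (Suc N'))" by (metis max.cobounded2)
      then show ?thesis using uniformly_inside_imp_subset[OF C] by blast
    qed
    with d(1)[of N'] show ?thesis by blast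
  qed
  with d show thesis by (rule that)
qed

end

section \<open>A function with prescribed discontinuities\<close>

lemma Inf_le_Inf_add:
  fixes A B :: "real set"
  assumes "A \<noteq> {}" "bdd_below B" "\<And>p. p \<in> A \<Longrightarrow> \<exists>q\<in>B. q \<le> p + L"
  shows "Inf B \<le> Inf A + L"
proof -
  have "Inf B - L \<le> Inf A"
  proof (rule cInf_greatest[OF assms(1)])
    fix p assume "p \<in> A"
    then obtain q where "q \<in> B" "q \<le> p + L" using assms(3) by blast
    then show "Inf B - L \<le> p" using cInf_lower[OF _ assms(2)] by fastforce
  qed
  then show ?thesis by simp
qed

lemma inverse_add_one_le:
  fixes s t :: real
  assumes "0 \<le> s" "0 \<le> t"
  shows "inverse (1 + s) \<le> inverse (1 + t) + \<bar>s - t\<bar>"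
proof -
  have "inverse (1 + s) - inverse (1 + t) = (t - s) * (inverse (1 + s) * inverse (1 + t))"
    using assms by (simp add: field_simps)
  also have "\<dots> \<le> \<bar>t - s\<bar> * 1"
  proof (rule mult_mono)
    show "inverse (1 + s) * inverse (1 + t) \<le> 1"
      using assms mult_mono[of "inverse (1 + s)" 1 "inverse (1 + t)" 1] by (simp add: inverse_le_1_iff)
  qed (use assms in auto)
  finally show ?thesis by (simp add: abs_minus_commute)
qed

context normed_space_product
begin

text \<open>
  The deviation of \<open>x\<close> from a point \<open>y\<close> of \<open>slice m\<close>. Beyond \<open>m\<close>, where \<open>y\<close> agrees with \<open>a\<close>, it is
  damped so that it is small on \<open>\<tau>\<close>-neighbourhoods of \<open>y\<close>; below \<open>m\<close> it is measured in units of \<open>d\<close>.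
\<close>

definition deviation :: "(nat \<Rightarrow> real) \<Rightarrow> nat \<Rightarrow> (nat \<Rightarrow> 'a) \<Rightarrow> nat \<Rightarrow> (nat \<Rightarrow> 'a) \<Rightarrow> real"
  where "deviation d m y i x =
    (if i < m then coord_dist i x y / d i else min (inverse (real (Suc i))) (coord_dist i x a))"

text \<open>The second family consists of all upper bounds of the deviations, so taking the infimum
  yields the infimum of their suprema. A point y enters once for every slice that contains
  it.\<close>

definition levels :: "(nat \<Rightarrow> real) \<Rightarrow> (nat \<Rightarrow> 'a) set \<Rightarrow> (nat \<Rightarrow> 'a) \<Rightarrow> real set"
  where "levels d W x = range (\<lambda>i. inverse (1 + coord_dist i x a)) \<union>
    {r. \<exists>m. \<exists>y\<in>slice m - W. \<forall>i. deviation d m y i x \<le> r}"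

definition potential :: "(nat \<Rightarrow> real) \<Rightarrow> (nat \<Rightarrow> 'a) set \<Rightarrow> (nat \<Rightarrow> 'a) \<Rightarrow> real"
  where "potential d W x = Inf (levels d W x)"

lemma abs_coord_dist_diff_le:
  assumes "x \<in> \<sigma> V a" "x' \<in> \<sigma> V a" "y \<in> \<sigma> V a"
  shows "\<bar>coord_dist i x y - coord_dist i x' y\<bar> \<le> coord_dist i x x'"
  using coord_dist_triangle[OF assms, of i] coord_dist_triangle[OF assms(2,1,3), of i]
    coord_dist_commute[OF assms(1,2), of i] by linarith

context
  fixes d :: "nat \<Rightarrow> real"
  assumes d_pos: "\<And>i. 0 < d i" and d_le_1: "\<And>i. d i \<le> 1"
begin

section \<open>Bounds and strong separate continuity of the potential\<close>

lemma deviation_nonneg: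
  assumes "x \<in> \<sigma> V a" "y \<in> \<sigma> V a" shows "0 \<le> deviation d m y i x"
  using coord_dist_nonneg[OF assms(1)] assms(2) d_pos by (simp add: deviation_def less_imp_le)

lemma levels_nonneg:
  assumes "x \<in> \<sigma> V a" "r \<in> levels d W x" shows "0 \<le> r"
  using assms(2) unfolding levels_def
proof (elim UnE)
  assume "r \<in> range (\<lambda>i. inverse (1 + coord_dist i x a))"
  then show ?thesis using coord_dist_nonneg[OF assms(1) base_in_\<sigma>] by auto
next
  assume "r \<in> {r. \<exists>m. \<exists>y\<in>slice m - W. \<forall>i. deviation d m y i x \<le> r}"
  then obtain m y where y: "y \<in> slice m" "\<forall>i. deviation d m y i x \<le> r" by blast
  then show ?thesis
    using deviation_nonneg[OF assms(1) slice_\<sigma>[OF y(1)], of m 0] by (meson order.trans)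
qed

lemma bdd_below_levels: "x \<in> \<sigma> V a \<Longrightarrow> bdd_below (levels d W x)"
  by (rule bdd_belowI[of _ 0]) (rule levels_nonneg)

lemma levels_nonempty: "levels d W x \<noteq> {}"
  by (auto simp: levels_def)

lemma potential_nonneg: "x \<in> \<sigma> V a \<Longrightarrow> 0 \<le> potential d W x"
  unfolding potential_def by (rule cInf_greatest[OF levels_nonempty]) (rule levels_nonneg)

lemma potential_le: "x \<in> \<sigma> V a \<Longrightarrow> r \<in> levels d W x \<Longrightarrow> potential d W x \<le> r"
  unfolding potential_def by (rule cInf_lower[OF _ bdd_below_levels])

text \<open>If coordinate n moves by s, a weighted deviation changes by at most s / d n, while the
  truncated ones and the terms of the first family change by at most s. Since
  \<open>d n \<le> 1\<close>, the former bound covers all cases, uniformly in y.\<close>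

lemma potential_lipschitz:
  assumes x: "x \<in> \<sigma> V a" "x' \<in> \<sigma> V a" and eq: "\<And>i. i \<noteq> n \<Longrightarrow> x i = x' i"
  shows "potential d W x \<le> potential d W x' + coord_dist n x x' / d n"
  unfolding potential_def
proof (rule Inf_le_Inf_add[OF levels_nonempty bdd_below_levels[OF x(1)]])
  let ?L = "coord_dist n x x' / d n"
  have L: "coord_dist n x x' \<le> ?L"
    using coord_dist_nonneg[OF x, of n] d_pos[of n] d_le_1[of n]
    by (simp add: le_divide_eq mult_left_le)
  have L0: "0 \<le> ?L" using L coord_dist_nonneg[OF x, of n] by linarith
  fix p assume "p \<in> levels d W x'"
  then consider i where "p = inverse (1 + coord_dist i x' a)"
    | m y where "y \<in> slice m - W" "\<forall>i. deviation d m y i x' \<le> p"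
    unfolding levels_def by blast
  then show "\<exists>q\<in>levels d W x. q \<le> p + ?L"
  proof cases
    case 1
    have "inverse (1 + coord_dist i x a) \<le> p + ?L"
    proof (cases "i = n")
      case True
      show ?thesis
        using inverse_add_one_le[OF coord_dist_nonneg[OF x(1) base_in_\<sigma>, of i]
            coord_dist_nonneg[OF x(2) base_in_\<sigma>, of i]]
          abs_coord_dist_diff_le[OF x base_in_\<sigma>, of i] L
        unfolding True 1 by linarith
    next
      case False
      then show ?thesis using eq[of i] L0 1 by (simp add: coord_dist_def)
    qed
    then show ?thesis unfolding levels_def by blast
  next
    case 2
    have y: "y \<in> \<sigma> V a" using 2(1) slice_\<sigma> by blast
    have "deviation d m y i x \<le> p + ?L" for i
    proof (cases "i = n")
      case True
      have "deviation d m y n x \<le> deviation d m y n x' + ?L"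
      proof (cases "n < m")
        case True
        have "coord_dist n x y / d n \<le> (coord_dist n x' y + coord_dist n x x') / d n"
          using coord_dist_triangle[OF x(1,2) y, of n] d_pos[of n] by (intro divide_right_mono) auto
        then show ?thesis using True by (simp add: deviation_def add_divide_distrib)
      next
        case False
        then show ?thesis
          using coord_dist_triangle[OF x base_in_\<sigma>, of n] L L0 by (simp add: deviation_def min_def)
      qed
      then show ?thesis using 2(2) True by (smt (verit))
    next
      case False
      then have "deviation d m y i x = deviation d m y i x'"
        using eq[of i] by (simp add: deviation_def coord_dist_def)
      then show ?thesis using 2(2) L0 by (simp add: add_increasing2)
    qed
    then have "p + ?L \<in> levels d W x" using 2(1) unfolding levels_def by blast
    then show ?thesis by blast
  qed
qed

lemma strongly_separately_continuous_potential:
  "strongly_separately_continuous V nrm a (potential d W)"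
  unfolding strongly_separately_continuous_iff
proof (intro ballI allI impI)
  fix u n and e :: real assume u: "u \<in> \<sigma> V a" and e: "e > 0"
  \<comment> \<open>\<open>Suc n\<close> is the least length that controls coordinate n; the factor
    \<open>d n\<close> in the radius cancels the Lipschitz constant.\<close>
  have "\<bar>potential d W x - potential d W (x(n := u n))\<bar> < e" if x: "x \<in> cylinder (Suc n) (e * d n) u" for x
  proof -
    have x\<sigma>: "x \<in> \<sigma> V a" and xu: "coord_dist n x u < e * d n" using x by (auto simp: cylinder_def)
    have x'\<sigma>: "x(n := u n) \<in> \<sigma> V a" by (intro fun_upd_in_\<sigma> x\<sigma> \<sigma>_coord u)
    have "coord_dist n x (x(n := u n)) / d n < e"
      using xu d_pos[of n] by (simp add: coord_dist_def pos_divide_less_eq)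
    then show ?thesis
      using potential_lipschitz[OF x\<sigma> x'\<sigma>, of n W] potential_lipschitz[OF x'\<sigma> x\<sigma>, of n W]
        coord_dist_commute[OF x\<sigma> x'\<sigma>, of n] by fastforce
  qed
  then show "\<exists>m r. r > 0 \<and> (\<forall>x\<in>cylinder m r u. \<bar>potential d W x - potential d W (x(n := u n))\<bar> < e)"
    using e d_pos[of n] by (intro exI[of _ "Suc n"] exI[of _ "e * d n"]) simp
qed

text \<open>The point u itself is the competitor y. Below k the radius makes the weighted deviations
  small; between k and M the distance to a is the distance to u; from M on the truncation is below e
  whatever x is.\<close>

lemma potential_small_near_complement:
  assumes u: "u \<in> \<sigma> V a" "u \<notin> W" and e: "e > 0"
  shows "\<exists>m r. r > 0 \<and> (\<forall>x\<in>cylinder m r u. potential d W x \<le> e)"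
proof -
  obtain k where k: "u \<in> slice k" by (rule \<sigma>_in_slice[OF u(1)])
  obtain M where M: "inverse (real (Suc M)) < e" using reals_Archimedean[OF e] by blast
  define r where "r = e * Min (insert 1 (d ` {..<k}))"
  have fin: "finite (insert 1 (d ` {..<k}))" by simp
  have "Min (insert 1 (d ` {..<k})) > 0" using d_pos by simp
  moreover have Min_le: "Min (insert 1 (d ` {..<k})) \<le> 1" "\<And>i. i < k \<Longrightarrow> Min (insert 1 (d ` {..<k})) \<le> d i"
    by (intro Min_le fin; simp)+
  ultimately have r: "r > 0" "r \<le> e" "\<And>i. i < k \<Longrightarrow> r \<le> e * d i"
    using e by (auto simp: r_def mult_left_le)
  have "potential d W x \<le> e" if x: "x \<in> cylinder (max k M) r u" for x
  proof (rule potential_le)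
    show "x \<in> \<sigma> V a" using x by (simp add: cylinder_def)
    have "deviation d k u i x \<le> e" for i
    proof (cases "i < k")
      case True
      then have "coord_dist i x u < r" using x by (simp add: cylinder_def)
      then have "coord_dist i x u \<le> e * d i" using r(3)[OF True] by linarith
      then show ?thesis using True d_pos[of i] by (simp add: deviation_def pos_divide_le_eq)
    next
      case False
      show ?thesis
      proof (cases "i < M")
        case True
        have "coord_dist i x u < r" using x True by (simp add: cylinder_def)
        then have "coord_dist i x a \<le> e"
          using False k r(2) by (simp add: coord_dist_def slice_def)
        then show ?thesis using False by (simp add: deviation_def)
      next
        case i: False
        then have "inverse (real (Suc i)) \<le> inverse (real (Suc M))" by (simp add: le_imp_inverse_le)
        then have "inverse (real (Suc i)) \<le> e" using M by linarith
        then show ?thesis using False by (simp add: deviation_def min.coboundedI1)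
      qed
    qed
    then show "e \<in> levels d W x" using k u(2) unfolding levels_def by blast
  qed
  with r(1) show ?thesis by blast
qed

lemma potential_eq_0:
  assumes "u \<in> \<sigma> V a" "u \<notin> W" shows "potential d W u = 0"
proof -
  have "potential d W u \<le> e" if "e > 0" for e
    using potential_small_near_complement[OF assms that] centre_in_cylinder[OF assms(1)] by blast
  then have "potential d W u \<le> 0" by (rule field_le_epsilon[of _ 0, simplified])
  with potential_nonneg[OF assms(1)] show ?thesis by (rule antisym[rotated])
qed

text \<open>A level that is too small would come from some \<open>y \<notin> W\<close> lying in the
  box around x, which is contained in W.\<close>

lemma potential_pos:
  assumes x: "x \<in> \<sigma> V a" and c: "c > 0" "\<And>y. y \<in> \<sigma> V a \<Longrightarrow> (\<And>i. coord_dist i y x < c * d i) \<Longrightarrow> y \<in> W"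
  shows "0 < potential d W x"
proof -
  obtain k where k: "x \<in> slice k" by (rule \<sigma>_in_slice[OF x])
  have fin: "finite (range (\<lambda>i. coord_dist i x a))"
  proof (rule finite_subset)
    show "range (\<lambda>i. coord_dist i x a) \<subseteq> insert 0 ((\<lambda>i. coord_dist i x a) ` {..<k})"
    proof (rule image_subsetI)
      fix i
      show "coord_dist i x a \<in> insert 0 ((\<lambda>i. coord_dist i x a) ` {..<k})"
        using k by (cases "i < k") (auto simp: slice_def coord_dist_eq)
    qed
  qed simp
  then obtain B where B: "\<And>i. coord_dist i x a \<le> B"
    using bdd_above_finite[OF fin] by (auto simp: bdd_above_def)
  have B0: "0 \<le> B" using B[of 0] coord_dist_nonneg[OF x base_in_\<sigma>, of 0] by linarith
  \<comment> \<open>One bound per case: 1/(1+B) for the first family; c for coordinates below m,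
    where the deviation is weighted; \<open>c * d i\<close> for i between m and k, where 1/(k+1)
    ensures that the truncation is not what makes the minimum small. Beyond both m and k, x and y
    agree with a.\<close>
  define S where "S = insert (inverse (1 + B)) (insert c (insert (inverse (real (Suc k))) ((\<lambda>i. c * d i) ` {..<k})))"
  have S: "finite S" "S \<noteq> {}" by (simp_all add: S_def)
  have pos: "0 < Min S" using S B0 c(1) d_pos by (auto simp: S_def)
  have le: "Min S \<le> s" if "s \<in> S" for s using S(1) that by (rule Min_le)
  have "Min S \<le> r" if "r \<in> levels d W x" for r
    using that unfolding levels_def
  proof (elim UnE)
    assume "r \<in> range (\<lambda>i. inverse (1 + coord_dist i x a))"
    then obtain i where i: "r = inverse (1 + coord_dist i x a)" by blast
    have "inverse (1 + B) \<le> r"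
      unfolding i using B[of i] coord_dist_nonneg[OF x base_in_\<sigma>, of i] by (intro le_imp_inverse_le) auto
    then show ?thesis using le[of "inverse (1 + B)"] by (simp add: S_def)
  next
    assume "r \<in> {r. \<exists>m. \<exists>y\<in>slice m - W. \<forall>i. deviation d m y i x \<le> r}"
    then obtain m y where y: "y \<in> slice m" "y \<notin> W" "\<And>i. deviation d m y i x \<le> r" by blast
    show ?thesis
    proof (rule ccontr)
      assume "\<not> Min S \<le> r"
      then have dev: "deviation d m y i x < Min S" for i using y(3)[of i] by simp
      have "coord_dist i y x < c * d i" for i
      proof -
        consider "i < m" | "m \<le> i" "i < k" | "m \<le> i" "k \<le> i" by linarith
        then have "coord_dist i x y < c * d i"
        proof cases
          case 1
          have "coord_dist i x y / d i < c" using dev[of i] le[of c] 1 by (simp add: deviation_def S_def)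
          then show ?thesis using d_pos[of i] by (simp add: pos_divide_less_eq)
        next
          case 2
          have "Min S \<le> inverse (real (Suc k))"
            by (rule le) (simp add: S_def)
          also have "\<dots> \<le> inverse (real (Suc i))"
            using 2 by (simp add: le_imp_inverse_le)
          finally have "Min S \<le> inverse (real (Suc i))" .
          moreover have "Min S \<le> c * d i"
            by (rule le) (use 2 in \<open>unfold S_def, blast\<close>)
          moreover have "coord_dist i x a = coord_dist i x y"
            using 2 y(1) by (simp add: slice_def coord_dist_def)
          then have "min (inverse (real (Suc i))) (coord_dist i x y) < Min S"
            using dev[of i] 2 by (simp add: deviation_def)
          ultimately show ?thesis by linarith
        next
          case 3
          then have "coord_dist i x y = 0" using k y(1) by (simp add: slice_def coord_dist_eq)
          then show ?thesis using c(1) d_pos[of i] by simp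
        qed
        then show ?thesis using coord_dist_commute[OF x slice_\<sigma>[OF y(1)]] by simp
      qed
      then show False using c(2)[OF slice_\<sigma>[OF y(1)]] y(2) by blast
    qed
  qed
  then have "Min S \<le> potential d W x"
    unfolding potential_def by (intro cInf_greatest levels_nonempty)
  with pos show ?thesis by linarith
qed

text \<open>A cylinder of length m leaves coordinate m free. The nonzero space \<open>V m\<close> is
  unbounded, so this coordinate can be moved far away from a, which makes a term of the first family
  small.\<close>

lemma potential_small_somewhere:
  assumes u: "u \<in> \<sigma> V a" and e: "e > 0" and r: "r > 0"
  shows "\<exists>x\<in>cylinder m r u. potential d W x < e"
proof -
  obtain v where v: "v \<in> V m" "v \<noteq> 0"
    using nontrivial[of m] factor.subspace[of m] subspace_0 by blast
  have nv: "nrm m v > 0" using v factor.nrm_nonneg[of v m] factor.nrm_eq_zero_iff[of v m] by simp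
  \<comment> \<open>Puts coordinate m at distance 1/e from a; the resulting level is e/(1+e), which
    is less than e.\<close>
  define t where "t = inverse e / nrm m v"
  have t: "t > 0" "t * nrm m v = inverse e" using nv e by (auto simp: t_def)
  define x where "x = u(m := a m + t *\<^sub>R v)"
  have "a m + t *\<^sub>R v \<in> V m"
    using v(1) \<sigma>_coord[OF base_in_\<sigma>, of m] by (simp add: factor.subspace subspace_add subspace_scale)
  then have x: "x \<in> \<sigma> V a" unfolding x_def by (rule fun_upd_in_\<sigma>[OF u])
  then have "x \<in> cylinder m r u" using r by (simp add: cylinder_def x_def coord_dist_def)
  moreover have eq: "coord_dist m x a = inverse e"
    using factor.nrm_scaleR[OF v(1), of t] t by (simp add: x_def coord_dist_def)
  have "inverse (1 + coord_dist m x a) \<in> levels d W x" unfolding levels_def by blast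
  then have "inverse (1 + inverse e) \<in> levels d W x" unfolding eq .
  then have "potential d W x \<le> inverse (1 + inverse e)" by (rule potential_le[OF x])
  moreover have "inverse (1 + inverse e) < e" using e by (simp add: field_simps)
  ultimately show ?thesis by (meson le_less_trans)
qed

section \<open>The discontinuity set of the potential\<close>

lemma discontinuity_set_potential:
  assumes W: "W \<subseteq> \<sigma> V a"
    and inner: "\<And>x. x \<in> W \<Longrightarrow> \<exists>c>0. \<forall>y\<in>\<sigma> V a. (\<forall>i. coord_dist i y x < c * d i) \<longrightarrow> y \<in> W"
  shows "discontinuity_set V nrm a (potential d W) = W"
proof -
  have "topcontinuous_at (\<sigma>_topology V nrm a) euclideanreal (potential d W) u \<longleftrightarrow> u \<notin> W"
    if u: "u \<in> \<sigma> V a" for u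
  proof
    assume "topcontinuous_at (\<sigma>_topology V nrm a) euclideanreal (potential d W) u"
    then have cont: "\<forall>e>0. \<exists>m r. r > 0 \<and> (\<forall>x\<in>cylinder m r u. \<bar>potential d W x - potential d W u\<bar> < e)"
      unfolding topcontinuous_at_iff[OF u] .
    show "u \<notin> W"
    proof
      assume "u \<in> W"
      then have g: "potential d W u / 2 > 0" using inner potential_pos[OF u] by (metis half_gt_zero)
      then obtain m r where r: "r > 0" "\<forall>x\<in>cylinder m r u. \<bar>potential d W x - potential d W u\<bar> < potential d W u / 2"
        using cont by blast
      obtain x where "x \<in> cylinder m r u" "potential d W x < potential d W u / 2"
        using potential_small_somewhere[OF u g r(1)] by blast
      with r(2) have "\<bar>potential d W x - potential d W u\<bar> < potential d W u / 2" by blast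
      with \<open>potential d W x < potential d W u / 2\<close> show False by linarith
    qed
  next
    assume uW: "u \<notin> W"
    show "topcontinuous_at (\<sigma>_topology V nrm a) euclideanreal (potential d W) u"
      unfolding topcontinuous_at_iff[OF u]
    proof (intro allI impI)
      fix e :: real assume e: "e > 0"
      obtain m r where "r > 0" "\<forall>x\<in>cylinder m r u. potential d W x \<le> e / 2"
        using potential_small_near_complement[OF u uW, of "e / 2"] e by auto
      moreover from this have "\<bar>potential d W x - potential d W u\<bar> < e" if "x \<in> cylinder m r u" for x
        using that e potential_nonneg[of x W] potential_eq_0[OF u uW] by (force simp: cylinder_def)
      ultimately show "\<exists>m r. r > 0 \<and> (\<forall>x\<in>cylinder m r u. \<bar>potential d W x - potential d W u\<bar> < e)"
        by blast
    qed
  qed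
  then show ?thesis using W by (auto simp: discontinuity_set_def)
qed

end

lemma nearly_open_is_discontinuity_set:
  assumes W: "nearly_open V nrm a W"
  shows "\<exists>f. strongly_separately_continuous V nrm a f \<and> discontinuity_set V nrm a f = W"
proof -
  have W\<sigma>: "W \<subseteq> \<sigma> V a" using W by (simp add: nearly_open_def)
  obtain d where d: "\<And>n. 0 < d n" "\<And>n. d n \<le> 1"
    "\<And>x. x \<in> W \<Longrightarrow> \<exists>c>0. \<forall>y\<in>\<sigma> V a. (\<forall>i. coord_dist i y x < c * d i) \<longrightarrow> y \<in> W"
    by (rule box_neighbourhoods[OF nearly_open_imp_slicewise_open[OF W] W\<sigma>]) (rule that)
  show ?thesis
    by (intro exI[of _ "potential d W"] conjI strongly_separately_continuous_potential[OF d(1,2)]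
        discontinuity_set_potential[OF d(1,2) W\<sigma> d(3)])
qed

end

theorem theorem5p4:
  fixes V :: "nat \<Rightarrow> 'a::real_vector set"
    and nrm :: "nat \<Rightarrow> 'a \<Rightarrow> real"
    and a :: "nat \<Rightarrow> 'a"
    and W :: "(nat \<Rightarrow> 'a) set"
  assumes "\<And>n. fin_dim_normed_space (V n) (nrm n)"
    and "\<And>n. V n \<noteq> {0}"
    and "a \<in> PiE UNIV V"
    and "W \<subseteq> \<sigma> V a"
  shows "(\<exists>f. strongly_separately_continuous V nrm a f \<and> discontinuity_set V nrm a f = W)
    \<longleftrightarrow> nearly_open V nrm a W"
proof -
  interpret normed_space_product V nrm a
    by (intro normed_space_product.intro assms(1-3))
  show ?thesis
    using nearly_open_discontinuity_set nearly_open_is_discontinuity_set by blast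
qed

end
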